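(* Let $p$ be a prime and $d\ge 2$ an integer. Let $\mathcal{P}_{d,p}$ be the set of monic polynomials $f(z)=z^d+a_{d-1}z^{d-1}+\dots+a_1z\in\mathbb{C}_p[z]$ of degree $d$ with $f(0)=0$, and let $\mathcal{M}_{d,p}\subseteq\mathcal{P}_{d,p}$ be the subset of those $f$ that are post-critically bounded (every critical point of $f$ has bounded forward orbit under iteration of $f$). Define \[ r(d,p)=\sup_{f\in\mathcal{M}_{d,p}}\ \max_{c\in\mathbb{C}_p,\ f'(c)=0}\{-v_p(c)\}. \] If $\frac12 d<p<d$, then $r(d,p)=\frac{p}{d-1}$. Further, if $p=\frac12 d$, then $r(d,p)=0$.
   Context: $\mathbb{C}_p$ is the completion of an algebraic closure of $\mathbb{Q}_p$, $v_p$ is the $p$-adic valuation normalized by $v_p(p)=1$, and $|x|=p^{-v_p(x)}$. *)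

theory Defs
  imports "HOL-Analysis.Analysis" "HOL-Computational_Algebra.Computational_Algebra"
begin

class nonarch_valued_field = field_char_0 + metric_space +
  fixes absval :: "'a \<Rightarrow> real"
  assumes dist_absval: "dist x y = absval (x - y)"
    and absval_mult: "absval (x * y) = absval x * absval y"
    and absval_add_le_max: "absval (x + y) \<le> max (absval x) (absval y)"

definition algebraic_over :: "'a::field set \<Rightarrow> 'a \<Rightarrow> bool" where
  "algebraic_over S x \<longleftrightarrow> (\<exists>g. g \<noteq> 0 \<and> (\<forall>i. coeff g i \<in> S) \<and> poly g x = 0)"

definition algebraically_closed_subset :: "'a::field set \<Rightarrow> bool" where
  "algebraically_closed_subset L \<longleftrightarrow>
     (\<forall>g. (\<forall>i. coeff g i \<in> L) \<and> degree g > 0 \<longrightarrow> (\<exists>x\<in>L. poly g x = 0))"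

text \<open>
  The field of \<open>p\<close>-adic complex numbers is determined, up to isometric isomorphism,
  as a complete non-archimedean field \<open>'a\<close> with \<open>absval p = 1/p\<close> (so that \<open>absval\<close> restricts to the
  \<open>p\<close>-adic absolute value on the rationals, and the closure of the rationals in \<open>'a\<close> is their
  \<open>p\<close>-adic completion) in which the elements algebraic over that closure form an
  algebraically closed field (hence an algebraic closure of the \<open>p\<close>-adic numbers) that is dense
  in \<open>'a\<close> (so that \<open>'a\<close> is its completion). Algebraic closedness of \<open>'a\<close> itself is
  not assumed.
\<close>

definition padic_numbers :: "'a::nonarch_valued_field set" where
  "padic_numbers = closure \<rat>"

definition padic_algebraic_numbers :: "'a::nonarch_valued_field set" where
  "padic_algebraic_numbers = {x. algebraic_over padic_numbers x}"

definition padic_complex_field :: "nat \<Rightarrow> 'a::nonarch_valued_field itself \<Rightarrow> bool" where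
  "padic_complex_field p _ \<longleftrightarrow>
     absval (of_nat p :: 'a) = 1 / real p \<and>
     algebraically_closed_subset (padic_algebraic_numbers :: 'a set) \<and>
     closure (padic_algebraic_numbers :: 'a set) = UNIV \<and>
     complete (UNIV :: 'a set)"

text \<open>The valuation with \<open>absval x = p powr (- padic_val p x)\<close> for \<open>x \<noteq> 0\<close>.\<close>

definition padic_val :: "nat \<Rightarrow> 'a::nonarch_valued_field \<Rightarrow> ereal" where
  "padic_val p x = (if x = 0 then \<infinity> else ereal (- log (real p) (absval x)))"

definition critical_points :: "'a::nonarch_valued_field poly \<Rightarrow> 'a set" where
  "critical_points f = {c. poly (pderiv f) c = 0}"

definition post_critically_bounded :: "'a::nonarch_valued_field poly \<Rightarrow> bool" where
  "post_critically_bounded f \<longleftrightarrow>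
     (\<forall>c\<in>critical_points f. bounded (range (\<lambda>n. (poly f ^^ n) c)))"

definition monic_polys :: "nat \<Rightarrow> 'a::nonarch_valued_field poly set" where
  "monic_polys d = {f. degree f = d \<and> lead_coeff f = 1 \<and> poly f 0 = 0}"

definition pcb_polys :: "nat \<Rightarrow> 'a::nonarch_valued_field poly set" where
  "pcb_polys d = {f \<in> monic_polys d. post_critically_bounded f}"

definition mandelbrot_radius :: "'a::nonarch_valued_field itself \<Rightarrow> nat \<Rightarrow> nat \<Rightarrow> ereal" where
  "mandelbrot_radius _ d p =
     (SUP f \<in> (pcb_polys d :: 'a poly set). Max ((\<lambda>c. - padic_val p c) ` critical_points f))"

end

theory Submission
  imports Defs
begin

text \<open>
  Write \<open>r\<close> for the largest absolute value of a critical point and suppose \<open>r > 1\<close>. If \<open>f\<close> is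
  post-critically bounded, all roots lie in the disc of radius \<open>r\<close>, so \<open>|f(c)| \<le> r < r^d\<close> forces
  every critical point \<open>c\<close> to be at distance less than \<open>r\<close> from some root. Group the roots into clusters
  of diameter less than \<open>r\<close>. By comparing the Newton polygons of \<open>f\<close> and \<open>f'\<close>, a cluster of \<open>n\<close> roots
  has only \<open>n - 1\<close> nearby critical points unless \<open>p\<close> divides \<open>n\<close>. There are at least two clusters but
  \<open>d - 1\<close> critical points, so this count must fail somewhere.

  For \<open>d = 2p\<close> the factor \<open>p\<close> in the leading coefficient of \<open>f'\<close> restores the count for
  clusters of \<open>p\<close> roots, a contradiction. For \<open>d/2 < p < d\<close> there is a single bad cluster, with
  \<open>p\<close> roots and at least \<open>p\<close> critical points. If all critical values were smaller than \<open>r^d / p^p\<close>,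
  the same count with radius \<open>r/p\<close> would put all \<open>p\<close> roots and all these critical points in one disc of
  radius less than \<open>r/p\<close>, which the coefficient \<open>p a_p\<close> of the derivative forbids. Hence
  \<open>r^d / p^p \<le> r\<close>.
\<close>

section \<open>Ultrametric absolute values\<close>

lemma absval_nonneg [simp]: "0 \<le> absval (x :: 'a::nonarch_valued_field)"
  using dist_absval[of x 0] by (metis diff_zero zero_le_dist)

lemma absval_eq_0_iff [simp]: "absval (x :: 'a::nonarch_valued_field) = 0 \<longleftrightarrow> x = 0"
  using dist_absval[of x 0] by (metis diff_zero dist_eq_0_iff)

lemma absval_0 [simp]: "absval (0 :: 'a::nonarch_valued_field) = 0"
  by simp

lemma absval_pos_iff [simp]: "0 < absval (x :: 'a::nonarch_valued_field) \<longleftrightarrow> x \<noteq> 0"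
  using absval_nonneg[of x] absval_eq_0_iff[of x] by linarith

lemma absval_1 [simp]: "absval (1 :: 'a::nonarch_valued_field) = 1"
  using absval_mult[of 1 "1 :: 'a"] absval_eq_0_iff[of "1 :: 'a"] by simp

lemma absval_minus_commute: "absval (x - y) = absval (y - x :: 'a::nonarch_valued_field)"
  by (metis dist_absval dist_commute)

lemma absval_minus [simp]: "absval (- x) = absval (x :: 'a::nonarch_valued_field)"
  using absval_minus_commute[of 0 x] by simp

lemma absval_diff_le_max: "absval (x - y) \<le> max (absval x) (absval (y :: 'a::nonarch_valued_field))"
  using absval_add_le_max[of x "- y"] by simp

lemma absval_diff_trans:
  "absval (x - z) \<le> max (absval (x - y)) (absval (y - z :: 'a::nonarch_valued_field))"
  using absval_add_le_max[of "x - y" "y - z"] by simp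

text \<open>Isosceles principle: the reverse estimate comes from writing \<open>y\<close> as
  \<open>(x + y) - x\<close>.\<close>

lemma absval_add_eq_right:
  "absval x < absval y \<Longrightarrow> absval (x + y) = absval (y :: 'a::nonarch_valued_field)"
  using absval_add_le_max[of x y] absval_diff_le_max[of "x + y" x] by (auto simp: max_def split: if_splits)

lemma absval_power [simp]: "absval (x ^ n) = absval (x :: 'a::nonarch_valued_field) ^ n"
  by (induction n) (auto simp: absval_mult)

lemma absval_prod: "absval (prod f A) = (\<Prod>x\<in>A. absval (f x :: 'a::nonarch_valued_field))"
  by (induction A rule: infinite_finite_induct) (auto simp: absval_mult)

lemma absval_inverse [simp]: "absval (inverse x) = inverse (absval (x :: 'a::nonarch_valued_field))"
proof (cases "x = 0")
  case False
  then have "absval x * absval (inverse x) = 1"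
    by (simp flip: absval_mult)
  then show ?thesis
    by (simp add: inverse_unique)
qed auto

lemma absval_divide [simp]:
  "absval (x / y) = absval x / absval (y :: 'a::nonarch_valued_field)"
  by (simp add: divide_inverse absval_mult)

lemma absval_sum_le:
  fixes f :: "'b \<Rightarrow> 'a::nonarch_valued_field"
  assumes "0 \<le> M" "\<And>x. x \<in> A \<Longrightarrow> absval (f x) \<le> M"
  shows "absval (sum f A) \<le> M"
  using assms(2)
proof (induction A rule: infinite_finite_induct)
  case (insert a A)
  then have "absval (f a) \<le> M" "absval (sum f A) \<le> M" by auto
  with insert.hyps show ?case
    using absval_add_le_max[of "f a" "sum f A"] by simp
qed (use assms(1) in auto)

lemma absval_sum_less:
  fixes f :: "'b \<Rightarrow> 'a::nonarch_valued_field"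
  assumes "0 < M" "\<And>x. x \<in> A \<Longrightarrow> absval (f x) < M"
  shows "absval (sum f A) < M"
  using assms(2)
proof (induction A rule: infinite_finite_induct)
  case (insert a A)
  then have "absval (f a) < M" "absval (sum f A) < M" by auto
  with insert.hyps show ?case
    using absval_add_le_max[of "f a" "sum f A"] by simp
qed (use assms(1) in auto)

lemma absval_of_nat_le_1: "absval (of_nat n :: 'a::nonarch_valued_field) \<le> 1"
proof (induction n)
  case (Suc n)
  then show ?case
    using absval_add_le_max[of 1 "of_nat n :: 'a"] by simp
qed auto

lemma absval_of_nat_mono_dvd:
  "m dvd n \<Longrightarrow> absval (of_nat n :: 'a::nonarch_valued_field) \<le> absval (of_nat m :: 'a)"
  using mult_left_le[OF absval_of_nat_le_1[where 'a='a] absval_nonneg]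
  by (auto simp: absval_mult elim!: dvdE)

text \<open>In the Bezout relation \<open>n * x = p * y + 1\<close> the right side has absolute
  value 1, and both factors on the left have absolute value at most 1.\<close>

lemma absval_of_nat_coprime:
  assumes "coprime n p" and "absval (of_nat p :: 'a::nonarch_valued_field) < 1"
  shows "absval (of_nat n :: 'a) = 1"
proof (cases "n = 0")
  case True
  then show ?thesis using assms by simp
next
  case False
  then obtain x y where "n * x = p * y + 1"
    using bezout_nat[of n p] assms(1) by auto
  then have eq: "(of_nat n :: 'a) * of_nat x = of_nat p * of_nat y + 1"
    by (metis of_nat_1 of_nat_add of_nat_mult)
  have "absval (of_nat p * of_nat y :: 'a) < absval (1 :: 'a)"
    using assms(2) mult_left_le[OF absval_of_nat_le_1[of y, where 'a='a], of "absval (of_nat p :: 'a)"]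
    by (simp add: absval_mult)
  then have "absval (of_nat n :: 'a) * absval (of_nat x :: 'a) = 1"
    using absval_add_eq_right[of "of_nat p * of_nat y :: 'a" 1] eq by (simp flip: absval_mult)
  then show ?thesis
    using absval_of_nat_le_1[of n, where 'a='a]
      mult_left_le[OF absval_of_nat_le_1[of x, where 'a='a], of "absval (of_nat n :: 'a)"] by simp
qed

lemma absval_poly_le:
  fixes q :: "'a::nonarch_valued_field poly"
  assumes "0 \<le> M" "\<And>i. i \<le> degree q \<Longrightarrow> absval (coeff q i) * absval x ^ i \<le> M"
  shows "absval (poly q x) \<le> M"
  unfolding poly_altdef using assms by (intro absval_sum_le) (auto simp: absval_mult)

section \<open>Algebraic closedness\<close>

lemma coeff_linear_mult:
  "coeff ([:- r, 1:] * q) i = (if i = 0 then 0 else coeff q (i - 1)) - r * coeff (q :: 'a::comm_ring_1 poly) i"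
  by (cases i) (auto simp: coeff_pCons)

lemma monic_degree_0_eq_1: "degree g = 0 \<Longrightarrow> lead_coeff g = 1 \<Longrightarrow> g = (1 :: 'a::comm_ring_1 poly)"
  by (auto elim!: degree_eq_zeroE)

lemma degree_prod_linear:
  "degree (\<Prod>j\<in>J. [:- (\<beta> j :: 'a::idom), 1:]) = card J"
  by (cases "finite J") (auto simp: degree_prod_eq_sum_degree)

lemma lead_coeff_prod_linear: "coeff (\<Prod>j\<in>J. [:- (\<beta> j :: 'a::idom), 1:]) (card J) = 1"
  using lead_coeff_prod[of "\<lambda>j. [:- \<beta> j, 1:]" J] by (simp add: degree_prod_linear)

lemma prod_linear_Suc:
  "(\<Prod>j<Suc n. [:- (case j of 0 \<Rightarrow> (r :: 'a::comm_ring_1) | Suc k \<Rightarrow> \<beta> k), 1:])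
    = [:- r, 1:] * (\<Prod>j<n. [:- \<beta> j, 1:])"
  by (subst prod.lessThan_Suc_shift) simp

lemma Rats_subset_padic_algebraic:
  assumes "x \<in> \<rat>"
  shows "x \<in> (padic_algebraic_numbers :: 'a::nonarch_valued_field set)"
proof -
  have "\<forall>i. coeff [:- x, 1:] i \<in> padic_numbers"
    using assms closure_subset[of "\<rat> :: 'a set"]
    by (auto simp: padic_numbers_def coeff_pCons split: nat.splits)
  then show ?thesis
    unfolding padic_algebraic_numbers_def algebraic_over_def
    by (intro CollectI exI[of _ "[:- x, 1:]"]) auto
qed

text \<open>
  Splitting off one root at a time and re-approximating the cofactor shows that split polynomials
  are dense; this only uses that the algebraic numbers contain a root of each polynomial over
  them, not that they form a field.
\<close>

lemma approx_by_split:
  fixes g :: "'a::nonarch_valued_field poly"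
  assumes cp: "padic_complex_field p TYPE('a)"
    and "degree g = n" "lead_coeff g = 1" "0 < e"
  shows "\<exists>\<beta>. \<forall>i. absval (coeff g i - coeff (\<Prod>j<n. [:- \<beta> j, 1:]) i) < e"
  using assms(2-)
proof (induction n arbitrary: g e)
  case 0
  then have "g = 1"
    by (simp add: monic_degree_0_eq_1)
  with 0 show ?case by simp
next
  case (Suc n)
  have "\<exists>y\<in>padic_algebraic_numbers. absval (coeff g i - y) < e" for i
  proof -
    have "coeff g i \<in> closure (padic_algebraic_numbers :: 'a set)"
      using cp by (simp add: padic_complex_field_def)
    then show ?thesis
      using \<open>0 < e\<close> unfolding closure_approachable by (metis absval_minus_commute dist_absval)
  qed
  then obtain y where y: "\<And>i. y i \<in> (padic_algebraic_numbers :: 'a set)"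
      "\<And>i. absval (coeff g i - y i) < e"
    by metis
  \<comment> \<open>Only the lower coefficients are replaced by algebraic ones; the leading 1 is
    rational, hence algebraic, so \<open>h\<close> stays monic of degree
    \<open>Suc n\<close>.\<close>
  define h where "h = monom 1 (Suc n) + (\<Sum>i\<le>n. monom (y i) i)"
  have ch: "coeff h i = (if i = Suc n then 1 else if i \<le> n then y i else 0)" for i
    by (auto simp: h_def coeff_sum sum.delta)
  have "coeff h i \<in> padic_algebraic_numbers" for i
    using y Rats_subset_padic_algebraic[of 0] Rats_subset_padic_algebraic[of 1]
    by (auto simp: ch)
  moreover have deg: "degree h = Suc n"
    by (intro antisym degree_le le_degree) (auto simp: ch)
  ultimately obtain r where "poly h r = 0"
    using cp unfolding padic_complex_field_def algebraically_closed_subset_def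
    by (metis zero_less_Suc)
  then obtain q where q: "h = [:- r, 1:] * q"
    by (auto simp: poly_eq_0_iff_dvd elim: dvdE)
  have "q \<noteq> 0" using deg q by auto
  then have "degree q = n" using deg q by (simp add: degree_mult_eq del: mult_pCons_left)
  moreover have "lead_coeff q = 1"
    using lead_coeff_mult[of "[:- r, 1:]" q] q deg ch[of "Suc n"] by simp
  \<comment> \<open>Multiplying the cofactor error by \<open>[:- r, 1:]\<close> gives a shifted copy
    minus \<open>r\<close> times a copy; this choice keeps both below \<open>e\<close>.\<close>
  moreover define e' where "e' = e / (1 + absval r)"
  have e': "0 < e'" "e' \<le> e" "absval r * e' < e"
    using \<open>0 < e\<close> by (auto simp: e'_def field_simps add_pos_nonneg add_nonneg_pos)
  ultimately obtain \<beta> where \<beta>: "\<And>i. absval (coeff q i - coeff (\<Prod>j<n. [:- \<beta> j, 1:]) i) < e'"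
    using Suc.IH by metis
  define s where "s = (\<Prod>j<n. [:- \<beta> j, 1:])"
  have "absval (coeff g i - coeff ([:- r, 1:] * s) i) < e" for i
  proof -
    have gh: "absval (coeff g i - coeff h i) < e"
      using y(2)[of i] Suc.prems coeff_eq_0[of g i] by (auto simp: ch)
    have 1: "absval (if i = 0 then 0 else coeff (q - s) (i - 1)) < e"
      using \<beta>[of "i - 1"] e' Suc.prems by (auto simp: s_def)
    have "absval (r * coeff (q - s) i) \<le> absval r * e'"
      using \<beta>[of i] by (auto simp: absval_mult s_def intro!: mult_left_mono)
    with e' have 2: "absval (r * coeff (q - s) i) < e" by simp
    have "coeff h i - coeff ([:- r, 1:] * s) i = coeff ([:- r, 1:] * (q - s)) i"
      by (simp add: q right_diff_distrib del: mult_pCons_left)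
    also have "absval \<dots> < e"
      unfolding coeff_linear_mult using 1 2 absval_diff_le_max
      by (smt (verit, best) max_less_iff_conj order_le_less_trans)
    finally show ?thesis
      using gh absval_diff_trans[of "coeff g i" "coeff ([:- r, 1:] * s) i" "coeff h i"] by simp
  qed
  then show ?case
    unfolding s_def prod_linear_Suc[symmetric] by blast
qed

section \<open>Existence of roots and splitting of monic polynomials\<close>

text \<open>Outside the disc of radius \<open>B\<close> the leading term strictly exceeds every
  other term, so the value cannot vanish.\<close>

lemma absval_root_le:
  fixes h :: "'a::nonarch_valued_field poly"
  assumes "lead_coeff h = 1" "poly h x = 0" "1 \<le> B" "\<And>i. absval (coeff h i) \<le> B"
  shows "absval x \<le> B"
proof (rule ccontr)
  assume x: "\<not> absval x \<le> B"
  define n where "n = degree h"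
  have "n > 0"
    using assms by (metis monic_degree_0_eq_1 n_def not_gr_zero poly_1 zero_neq_one)
  have "poly h x = (\<Sum>i<n. coeff h i * x ^ i) + x ^ n"
    using assms(1) by (simp add: poly_altdef n_def lessThan_Suc_atMost[symmetric])
  moreover have "absval (\<Sum>i<n. coeff h i * x ^ i) < absval (x ^ n)"
  proof (rule absval_sum_less)
    show "0 < absval (x ^ n)" using x assms(3) by (auto simp del: absval_power)
  next
    fix i assume "i \<in> {..<n}"
    then have "absval (coeff h i) * absval x ^ i \<le> B * absval x ^ (n - 1)"
      using x assms(3,4) by (intro mult_mono power_increasing) auto
    also have "\<dots> < absval x * absval x ^ (n - 1)"
      using x assms(3) by (intro mult_strict_right_mono zero_less_power) linarith+
    also have "\<dots> = absval x ^ n" using \<open>n > 0\<close> by (simp flip: power_Suc)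
    finally show "absval (coeff h i * x ^ i) < absval (x ^ n)" by (simp add: absval_mult)
  qed
  ultimately have "absval (poly h x) = absval (x ^ n)"
    by (metis absval_add_eq_right)
  then show False
    using assms x by auto
qed

text \<open>Turns a small value of a split monic polynomial into a nearby root.\<close>

lemma prod_less_imp_factor_less:
  fixes f :: "'b \<Rightarrow> real"
  assumes "prod f A < t ^ card A" "0 \<le> t"
  shows "\<exists>x\<in>A. f x < t"
proof (rule ccontr)
  assume "\<not> ?thesis"
  then have "(\<Prod>x\<in>A. t) \<le> prod f A"
    using assms by (intro prod_mono) auto
  then show False using assms by simp
qed

text \<open>Continuity of roots: roots of ever closer split approximations, each chosen near the
  previous one, form a Cauchy sequence, and its limit is a root of \<open>g\<close>.\<close>

lemma padic_complex_root_exists: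
  fixes g :: "'a::nonarch_valued_field poly"
  assumes cp: "padic_complex_field p TYPE('a)"
    and n: "degree g = n" "0 < n" and lc: "lead_coeff g = 1"
  shows "\<exists>x. poly g x = 0"
proof -
  define B where "B = Max (insert 1 ((\<lambda>i. absval (coeff g i)) ` {..n}))"
  have B: "1 \<le> B" by (auto simp: B_def)
  have gB: "absval (coeff g i) \<le> B" for i
  proof (cases "i \<le> n")
    case True
    then show ?thesis unfolding B_def by (intro Max_ge) auto
  next
    case False
    then have "coeff g i = 0" using n by (simp add: coeff_eq_0)
    then show ?thesis using B by simp
  qed
  \<comment> \<open>Coefficients within \<open>e k\<close> make values on the disc of radius
    \<open>B\<close> agree up to \<open>((1/2) ^ k) ^ n\<close>. This is an \<open>n\<close>-th
    power, so one of \<open>n\<close> linear factors is of order \<open>(1/2) ^ k\<close>.\<close>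
  define e :: "nat \<Rightarrow> real" where "e k = ((1/2) ^ k) ^ n / B ^ n" for k
  have Bn: "1 \<le> B ^ n" using B by simp
  have e: "0 < e k" "e k \<le> 1" "e (Suc k) \<le> e k" "e k * B ^ n = ((1/2) ^ k) ^ n" for k
  proof -
    show "0 < e k" "e k * B ^ n = ((1/2) ^ k) ^ n" using B by (auto simp: e_def)
    have "((1/2) ^ k) ^ n \<le> (1::real)" by (intro power_le_one) auto
    then show "e k \<le> 1" using Bn unfolding e_def by (subst divide_le_eq_1_pos) linarith+
    have "((1/2) ^ Suc k) ^ n \<le> ((1/2::real) ^ k) ^ n"
      by (intro power_mono power_decreasing) auto
    then show "e (Suc k) \<le> e k" unfolding e_def using B by (intro divide_right_mono) auto
  qed
  define P where "P k x \<longleftrightarrow> (\<exists>\<beta>. (\<forall>i. absval (coeff g i - coeff (\<Prod>j<n. [:- \<beta> j, 1:]) i) < e k)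
      \<and> poly (\<Prod>j<n. [:- \<beta> j, 1:]) x = 0)" for k x
  have split_root_le: "absval x \<le> B"
    if "\<forall>i. absval (coeff g i - coeff (\<Prod>j<n. [:- \<beta> j, 1:]) i) < e k"
       "poly (\<Prod>j<n. [:- \<beta> j, 1:]) x = 0" for k \<beta> x
  proof (rule absval_root_le[OF _ that(2) B])
    show "lead_coeff (\<Prod>j<n. [:- \<beta> j, 1:]) = 1"
      using lead_coeff_prod_linear[of \<beta> "{..<n}"] by (simp add: degree_prod_linear)
    show "absval (coeff (\<Prod>j<n. [:- \<beta> j, 1:]) i) \<le> B" for i
    proof -
      let ?c = "coeff (\<Prod>j<n. [:- \<beta> j, 1:]) i"
      have "absval ?c \<le> max (absval (coeff g i)) (absval (coeff g i - ?c))"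
        using absval_diff_le_max[of "coeff g i" "coeff g i - ?c"] by simp
      moreover have "absval (coeff g i - ?c) \<le> B"
        using that(1)[rule_format, of i] e(2)[of k] B by linarith
      ultimately show ?thesis using gB[of i] by auto
    qed
  qed
  have close: "absval (poly g x - poly (\<Prod>j<n. [:- \<beta> j, 1:]) x) \<le> ((1/2) ^ k) ^ n"
    if "\<forall>i. absval (coeff g i - coeff (\<Prod>j<n. [:- \<beta> j, 1:]) i) < e k" "absval x \<le> B" for k \<beta> x
  proof -
    have "degree (g - (\<Prod>j<n. [:- \<beta> j, 1:])) \<le> n"
      using n degree_prod_linear[of \<beta> "{..<n}"] by (intro degree_diff_le) auto
    then have "absval (poly (g - (\<Prod>j<n. [:- \<beta> j, 1:])) x) \<le> e k * B ^ n"
    proof (intro absval_poly_le)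
      fix i assume i: "i \<le> degree (g - (\<Prod>j<n. [:- \<beta> j, 1:]))"
        "degree (g - (\<Prod>j<n. [:- \<beta> j, 1:])) \<le> n"
      have "absval x ^ i \<le> B ^ i" using that by (intro power_mono) auto
      also have "\<dots> \<le> B ^ n" using i B by (intro power_increasing) auto
      finally show "absval (coeff (g - (\<Prod>j<n. [:- \<beta> j, 1:])) i) * absval x ^ i \<le> e k * B ^ n"
        using that(1)[rule_format, of i] e(1)[of k] by (intro mult_mono) auto
    qed (use e(1)[of k] B in auto)
    then show ?thesis using e(4)[of k] by simp
  qed
  have "\<exists>x. P 0 x"
  proof -
    obtain \<beta> where "\<forall>i. absval (coeff g i - coeff (\<Prod>j<n. [:- \<beta> j, 1:]) i) < e 0"
      using approx_by_split[OF cp n(1) lc e(1)] by blast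
    moreover have "poly (\<Prod>j<n. [:- \<beta> j, 1:]) (\<beta> 0) = 0"
      using n(2) by (auto simp: poly_prod)
    ultimately show ?thesis unfolding P_def by blast
  qed
  moreover have "\<exists>y. P (Suc k) y \<and> absval (y - x) < 2 * (1/2) ^ k" if Px: "P k x" for k x
  proof -
    obtain \<alpha> where \<alpha>: "\<forall>i. absval (coeff g i - coeff (\<Prod>j<n. [:- \<alpha> j, 1:]) i) < e k"
        "poly (\<Prod>j<n. [:- \<alpha> j, 1:]) x = 0"
      using Px P_def by blast
    obtain \<beta> where \<beta>: "\<forall>i. absval (coeff g i - coeff (\<Prod>j<n. [:- \<beta> j, 1:]) i) < e (Suc k)"
      using approx_by_split[OF cp n(1) lc e(1)] by blast
    then have \<beta>k: "\<forall>i. absval (coeff g i - coeff (\<Prod>j<n. [:- \<beta> j, 1:]) i) < e k"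
      using e(3)[of k] by (meson less_le_trans)
    have xB: "absval x \<le> B" using split_root_le[OF \<alpha>] .
    have "absval (poly (\<Prod>j<n. [:- \<beta> j, 1:]) x) \<le> ((1/2) ^ k) ^ n"
      using close[OF \<alpha>(1) xB] close[OF \<beta>k xB] \<alpha>(2)
        absval_diff_le_max[of "poly g x" "poly g x - poly (\<Prod>j<n. [:- \<beta> j, 1:]) x"] by simp
    \<comment> \<open>The factor 2 provides the strict inequality needed to extract a single small
      factor.\<close>
    also have "\<dots> < (2 * (1/2) ^ k) ^ n"
      using n(2) by (intro power_strict_mono) auto
    finally have "(\<Prod>j<n. absval (x - \<beta> j)) < (2 * (1/2) ^ k) ^ card {..<n}"
      by (simp add: poly_prod absval_prod)
    then obtain j where j: "j < n" "absval (x - \<beta> j) < 2 * (1/2) ^ k"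
      using prod_less_imp_factor_less by (metis (no_types, lifting) lessThan_iff mult_nonneg_nonneg
          zero_le_numeral zero_le_power zero_le_divide_1_iff)
    have "poly (\<Prod>j<n. [:- \<beta> j, 1:]) (\<beta> j) = 0"
      using j(1) by (auto simp: poly_prod)
    then have "P (Suc k) (\<beta> j)" using \<beta> unfolding P_def by blast
    then show ?thesis using j(2) by (auto simp: absval_minus_commute)
  qed
  ultimately obtain X where X: "\<And>k. P k (X k)" "\<And>k. absval (X (Suc k) - X k) < 2 * (1/2) ^ k"
    using dependent_nat_choice[of P "\<lambda>k x y. absval (y - x) < 2 * (1/2) ^ k"] by blast
  \<comment> \<open>In an ultrametric a chain of steps is bounded by its largest step, so no
    geometric series is summed.\<close>
  have X_close: "absval (X (k + m) - X k) < 2 * (1/2) ^ k" for k m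
  proof (induction m)
    case (Suc m)
    have "2 * (1/2) ^ (k + m) \<le> 2 * (1/2::real) ^ k" by (intro mult_left_mono power_decreasing) auto
    then show ?case
      using Suc X(2)[of "k + m"] absval_diff_trans[of "X (Suc (k + m))" "X k" "X (k + m)"]
      unfolding add_Suc_right by linarith
  qed auto
  have small: "\<exists>N. \<forall>k\<ge>N. 2 * (1/2) ^ k < \<epsilon>" if "0 < \<epsilon>" for \<epsilon> :: real
  proof -
    have "(\<lambda>k. 2 * (1/2::real) ^ k) \<longlonglongrightarrow> 2 * 0"
      by (intro tendsto_mult LIMSEQ_power_zero tendsto_const) auto
    then show ?thesis
      using order_tendstoD(2)[of _ "2 * 0" sequentially \<epsilon>] that by (auto simp: eventually_sequentially)
  qed
  have "Cauchy X"
    unfolding Cauchy_altdef2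
  proof (intro allI impI)
    fix \<epsilon> :: real assume "0 < \<epsilon>"
    then obtain N where "2 * (1/2) ^ N < \<epsilon>" using small by blast
    then have "\<forall>k\<ge>N. dist (X k) (X N) < \<epsilon>"
      using X_close[of N] by (metis dist_absval le_Suc_ex less_trans)
    then show "\<exists>N. \<forall>k\<ge>N. dist (X k) (X N) < \<epsilon>" by blast
  qed
  then obtain x where x: "X \<longlonglongrightarrow> x"
    using cp unfolding padic_complex_field_def complete_def by blast
  have x_close: "absval (x - X k) < 2 * (1/2) ^ k" for k
  proof -
    obtain N where N: "\<And>m. m \<ge> N \<Longrightarrow> dist (X m) x < 2 * (1/2) ^ k"
      using x unfolding lim_sequentially by (metis mult_pos_pos zero_less_divide_1_iff zero_less_numeral zero_less_power)
    have "absval (x - X (k + N)) < 2 * (1/2) ^ k"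
      using N[of "k + N"] by (simp add: dist_absval absval_minus_commute)
    then show ?thesis
      using X_close[of k N] absval_diff_trans[of x "X k" "X (k + N)"]
      by (auto simp: max_def split: if_splits)
  qed
  \<comment> \<open>At the limit one factor of the approximating product is \<open>x - X k\<close>,
    which is small, and the others are at most \<open>B\<close>. Hence \<open>g\<close> at
    \<open>x\<close> is bounded by a null sequence.\<close>
  have "absval (poly g x) \<le> 2 * (1/2) ^ k * B ^ n" for k
  proof -
    obtain \<beta> where \<beta>: "\<forall>i. absval (coeff g i - coeff (\<Prod>j<n. [:- \<beta> j, 1:]) i) < e k"
        "poly (\<Prod>j<n. [:- \<beta> j, 1:]) (X k) = 0"
      using X(1)[of k] P_def by blast
    obtain j where j: "j < n" "X k = \<beta> j"
      using \<beta>(2) by (auto simp: poly_prod)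
    obtain N where "2 * (1/2) ^ N < B" using small[of B] B by auto
    moreover obtain \<beta>' where "\<forall>i. absval (coeff g i - coeff (\<Prod>j<n. [:- \<beta>' j, 1:]) i) < e N"
        "poly (\<Prod>j<n. [:- \<beta>' j, 1:]) (X N) = 0"
      using X(1)[of N] P_def by blast
    ultimately have xB: "absval x \<le> B"
      using split_root_le[of \<beta>' N "X N"] x_close[of N] absval_add_le_max[of "x - X N" "X N"] by simp
    have "absval (x - \<beta> l) \<le> B" if "l < n" for l
    proof -
      have "poly (\<Prod>j<n. [:- \<beta> j, 1:]) (\<beta> l) = 0" using that by (auto simp: poly_prod)
      then show ?thesis
        using split_root_le[OF \<beta>(1)] xB absval_diff_le_max[of x "\<beta> l"] by (meson max.boundedI order_trans)
    qed
    then have "(\<Prod>l\<in>{..<n} - {j}. absval (x - \<beta> l)) \<le> (\<Prod>l\<in>{..<n} - {j}. B)"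
      by (intro prod_mono) auto
    also have "\<dots> \<le> B ^ n"
      using B j(1) by (auto intro!: power_increasing)
    finally have "absval (x - \<beta> j) * (\<Prod>l\<in>{..<n} - {j}. absval (x - \<beta> l)) \<le> 2 * (1/2) ^ k * B ^ n"
      using x_close[of k] j(2) by (intro mult_mono) (auto intro!: prod_nonneg)
    then have "absval (poly (\<Prod>j<n. [:- \<beta> j, 1:]) x) \<le> 2 * (1/2) ^ k * B ^ n"
      using j(1) prod.remove[of "{..<n}" j "\<lambda>l. absval (x - \<beta> l)"] by (simp add: poly_prod absval_prod)
    moreover have "absval (poly g x - poly (\<Prod>j<n. [:- \<beta> j, 1:]) x) \<le> 2 * (1/2) ^ k * B ^ n"
    proof -
      have "((1/2) ^ k) ^ n \<le> ((1/2::real) ^ k) ^ 1"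
        using n(2) by (intro power_decreasing power_le_one) auto
      also have "\<dots> \<le> 2 * (1/2) ^ k * 1" by simp
      also have "\<dots> \<le> 2 * (1/2) ^ k * B ^ n" using Bn by (intro mult_left_mono) auto
      finally show ?thesis using close[OF \<beta>(1) xB] by linarith
    qed
    ultimately show ?thesis
      using absval_add_le_max[of "poly g x - poly (\<Prod>j<n. [:- \<beta> j, 1:]) x" "poly (\<Prod>j<n. [:- \<beta> j, 1:]) x"]
      by simp
  qed
  moreover have "(\<lambda>k. 2 * (1/2::real) ^ k * B ^ n) \<longlonglongrightarrow> 2 * 0 * B ^ n"
    by (intro tendsto_mult LIMSEQ_power_zero tendsto_const) auto
  ultimately have "absval (poly g x) \<le> 0"
    using LIMSEQ_le_const[of "\<lambda>k. 2 * (1/2::real) ^ k * B ^ n" "2 * 0 * B ^ n" "absval (poly g x)"] by simp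
  then have "poly g x = 0" using absval_nonneg[of "poly g x"] absval_eq_0_iff by (metis antisym)
  then show ?thesis by blast
qed

lemma padic_complex_monic_splits:
  fixes g :: "'a::nonarch_valued_field poly"
  assumes cp: "padic_complex_field p TYPE('a)" and "degree g = n" "lead_coeff g = 1"
  shows "\<exists>\<beta>. g = (\<Prod>j<n. [:- \<beta> j, 1:])"
  using assms(2-)
proof (induction n arbitrary: g)
  case 0
  then have "g = 1" by (simp add: monic_degree_0_eq_1)
  then show ?case by simp
next
  case (Suc n)
  then obtain r where "poly g r = 0"
    using padic_complex_root_exists[OF cp] by blast
  then obtain q where q: "g = [:- r, 1:] * q"
    by (auto simp: poly_eq_0_iff_dvd elim: dvdE)
  have "q \<noteq> 0" using Suc.prems q by auto
  then have "degree q = n" using Suc.prems q by (simp add: degree_mult_eq del: mult_pCons_left)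
  moreover have "lead_coeff q = 1"
    using lead_coeff_mult[of "[:- r, 1:]" q] q Suc.prems by simp
  ultimately obtain \<beta> where "q = (\<Prod>j<n. [:- \<beta> j, 1:])" using Suc.IH by blast
  then show ?case using q prod_linear_Suc[of r \<beta> n] by metis
qed

section \<open>Counting roots in balls\<close>

text \<open>The index of the leftmost term of maximal size on the sphere of radius \<open>t\<close>, that is, the
  abscissa of a vertex of the Newton polygon.\<close>

definition dominant :: "real \<Rightarrow> nat \<Rightarrow> 'a::nonarch_valued_field poly \<Rightarrow> bool" where
  "dominant t n g \<longleftrightarrow> coeff g n \<noteq> 0 \<and>
     (\<forall>i. absval (coeff g i) * t ^ i \<le> absval (coeff g n) * t ^ n) \<and>
     (\<forall>i<n. absval (coeff g i) * t ^ i < absval (coeff g n) * t ^ n)"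

text \<open>Gauss's lemma at radius \<open>t\<close>: in the coefficient of index
  \<open>n + m\<close> every pair other than \<open>(n, m)\<close> has its first index below
  \<open>n\<close> or its second below \<open>m\<close>, hence is strictly smaller. The same
  dichotomy handles all indices below \<open>n + m\<close>.\<close>

lemma dominant_mult:
  assumes g: "dominant t n g" and h: "dominant t m h" and t: "0 < t"
  shows "dominant t (n + m) (g * h)"
proof -
  define A where "A = absval (coeff g n) * t ^ n"
  define B where "B = absval (coeff h m) * t ^ m"
  have pos: "0 < A" "0 < B"
    using g h t by (auto simp: A_def B_def dominant_def)
  have term_eq: "absval (coeff g i * coeff h (k - i)) * t ^ k
      = (absval (coeff g i) * t ^ i) * (absval (coeff h (k - i)) * t ^ (k - i))" if "i \<le> k" for i k
  proof -
    have "t ^ k = t ^ i * t ^ (k - i)" using that by (simp flip: power_add)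
    then show ?thesis by (simp only: absval_mult ac_simps)
  qed
  have le: "absval (coeff g i * coeff h (k - i)) * t ^ k \<le> A * B" if "i \<le> k" for i k
    unfolding term_eq[OF that] using g h t pos by (intro mult_mono) (auto simp: A_def B_def dominant_def)
  have less: "absval (coeff g i * coeff h (k - i)) * t ^ k < A * B"
    if "i \<le> k" "i < n \<or> k - i < m" for i k
    using that(2)
  proof
    assume "i < n"
    then have "absval (coeff g i) * t ^ i < A" using g by (auto simp: A_def dominant_def)
    moreover have "absval (coeff h (k - i)) * t ^ (k - i) \<le> B" using h by (auto simp: B_def dominant_def)
    ultimately show ?thesis
      unfolding term_eq[OF that(1)] using t pos
      by (intro le_less_trans[OF mult_left_mono mult_strict_right_mono]) auto
  next
    assume "k - i < m"
    then have "absval (coeff h (k - i)) * t ^ (k - i) < B" using h by (auto simp: B_def dominant_def)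
    moreover have "absval (coeff g i) * t ^ i \<le> A" using g by (auto simp: A_def dominant_def)
    ultimately show ?thesis
      unfolding term_eq[OF that(1)] using t pos
      by (intro le_less_trans[OF mult_right_mono mult_strict_left_mono]) auto
  qed
  have divide_bound: "x * t ^ k \<le> A * B \<longleftrightarrow> x \<le> A * B / t ^ k" "x * t ^ k < A * B \<longleftrightarrow> x < A * B / t ^ k"
    for x k using t by (simp_all add: field_simps)
  have AB: "0 < A * B / t ^ k" for k using pos t by simp
  have all_le: "absval (coeff (g * h) k) * t ^ k \<le> A * B" for k
    unfolding coeff_mult divide_bound using le[unfolded divide_bound] AB[of k]
    by (intro absval_sum_le) auto
  have all_less: "absval (coeff (g * h) k) * t ^ k < A * B" if "k < n + m" for k
    unfolding coeff_mult divide_bound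
  proof (intro absval_sum_less AB)
    fix i assume i: "i \<in> {..k}"
    then have "i < n \<or> k - i < m" using that by auto
    then show "absval (coeff g i * coeff h (k - i)) < A * B / t ^ k"
      using less[of i k] i unfolding divide_bound by simp
  qed
  have "coeff (g * h) (n + m)
      = (\<Sum>i\<in>{..n + m} - {n}. coeff g i * coeff h (n + m - i)) + coeff g n * coeff h m"
    unfolding coeff_mult by (subst sum.remove[of _ n]) auto
  moreover have "absval (\<Sum>i\<in>{..n + m} - {n}. coeff g i * coeff h (n + m - i)) < A * B / t ^ (n + m)"
  proof (intro absval_sum_less AB)
    fix i assume i: "i \<in> {..n + m} - {n}"
    then have "i < n \<or> n + m - i < m" by auto
    then show "absval (coeff g i * coeff h (n + m - i)) < A * B / t ^ (n + m)"
      using less[of i "n + m"] i unfolding divide_bound by simp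
  qed
  moreover have "absval (coeff g n * coeff h m) = A * B / t ^ (n + m)"
    using t by (simp add: A_def B_def absval_mult power_add)
  ultimately have "absval (coeff (g * h) (n + m)) = A * B / t ^ (n + m)"
    by (simp add: absval_add_eq_right)
  then have eq: "absval (coeff (g * h) (n + m)) * t ^ (n + m) = A * B"
    using t by simp
  then have "coeff (g * h) (n + m) \<noteq> 0"
    using pos by (metis absval_0 less_irrefl mult_pos_pos mult_zero_left)
  then show ?thesis
    unfolding dominant_def eq using all_le all_less by blast
qed

lemma dominant_const: "a \<noteq> 0 \<Longrightarrow> 0 < t \<Longrightarrow> dominant t 0 [:a:]"
  by (auto simp: dominant_def coeff_pCons split: nat.splits)

text \<open>On the boundary \<open>absval b = t\<close> both terms are equally large and the
  leftmost one counts, which is why roots are counted in open discs.\<close>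

lemma dominant_linear:
  "0 < t \<Longrightarrow> dominant t (if absval b < t then 1 else 0) [:- b, 1:]"
  by (auto simp: dominant_def coeff_pCons split: nat.splits)

lemma pcompose_linear_mult:
  fixes a b u :: "'a::comm_ring_1"
  shows "pcompose (smult a ([:- b, 1:] * q)) [:u, 1:] = [:- (b - u), 1:] * pcompose (smult a q) [:u, 1:]"
proof -
  have "pcompose [:- b, 1:] [:u, 1:] = [:- (b - u), 1:]"
    by (simp add: pcompose_pCons)
  then show ?thesis
    by (simp only: pcompose_mult pcompose_smult mult_smult_right)
qed

text \<open>Newton polygon count: each linear factor contributes 1 exactly when its root lies in the
  open disc of radius \<open>t\<close> about \<open>u\<close>, and dominant indices add under
  multiplication.\<close>

lemma dominant_split:
  fixes a u :: "'a::nonarch_valued_field"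
  assumes "finite J" "0 < t" "a \<noteq> 0"
  shows "dominant t (card {j\<in>J. absval (\<beta> j - u) < t})
    (pcompose (smult a (\<Prod>j\<in>J. [:- \<beta> j, 1:])) [:u, 1:])"
  using assms(1)
proof (induction J rule: finite_induct)
  case empty
  then show ?case using assms dominant_const[of a t] by simp
next
  case (insert j J)
  have "{k \<in> insert j J. absval (\<beta> k - u) < t} =
      (if absval (\<beta> j - u) < t then insert j {k\<in>J. absval (\<beta> k - u) < t}
       else {k\<in>J. absval (\<beta> k - u) < t})" by auto
  then have card: "card {k \<in> insert j J. absval (\<beta> k - u) < t} =
      (if absval (\<beta> j - u) < t then 1 else 0) + card {k\<in>J. absval (\<beta> k - u) < t}"
    using insert.hyps by simp
  have eq: "pcompose (smult a (\<Prod>j\<in>insert j J. [:- \<beta> j, 1:])) [:u, 1:]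
      = [:- (\<beta> j - u), 1:] * pcompose (smult a (\<Prod>j\<in>J. [:- \<beta> j, 1:])) [:u, 1:]"
    unfolding prod.insert[OF insert.hyps] by (rule pcompose_linear_mult)
  show ?case
    unfolding card eq by (rule dominant_mult[OF dominant_linear[OF assms(2)] insert.IH assms(2)])
qed

text \<open>The Gauss norm of radius \<open>r\<close> is submultiplicative, and after recentering at
  \<open>u\<close> each linear factor has norm \<open>r\<close>.\<close>

lemma coeff_split_bound:
  fixes a u :: "'a::nonarch_valued_field"
  assumes "finite J" "0 < r" "\<And>j. j \<in> J \<Longrightarrow> absval (\<beta> j - u) \<le> r"
  shows "absval (coeff (pcompose (smult a (\<Prod>j\<in>J. [:- \<beta> j, 1:])) [:u, 1:]) k) * r ^ k
    \<le> absval a * r ^ card J"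
  using assms(1,3)
proof (induction J arbitrary: k rule: finite_induct)
  case empty
  then show ?case using assms by (auto simp: coeff_pCons split: nat.splits)
next
  case (insert j J)
  define g where "g = pcompose (smult a (\<Prod>j\<in>J. [:- \<beta> j, 1:])) [:u, 1:]"
  define M where "M = absval a * r ^ card J"
  have IH: "absval (coeff g k) * r ^ k \<le> M" for k
    using insert by (auto simp: g_def M_def)
  have M: "0 \<le> M" using assms by (simp add: M_def)
  have eq: "pcompose (smult a (\<Prod>j\<in>insert j J. [:- \<beta> j, 1:])) [:u, 1:] = [:- (\<beta> j - u), 1:] * g"
    unfolding g_def prod.insert[OF insert.hyps] by (rule pcompose_linear_mult)
  have 1: "absval (if k = 0 then 0 else coeff g (k - 1)) * r ^ k \<le> r * M"
    using IH[of "k - 1"] M assms(2) by (cases k) auto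
  have "absval (\<beta> j - u) * (absval (coeff g k) * r ^ k) \<le> r * M"
    using insert.prems IH[of k] assms(2) by (intro mult_mono) auto
  then have 2: "absval ((\<beta> j - u) * coeff g k) * r ^ k \<le> r * M"
    by (simp add: absval_mult ac_simps)
  have "absval (coeff ([:- (\<beta> j - u), 1:] * g) k) * r ^ k
      \<le> max (absval (if k = 0 then 0 else coeff g (k - 1))) (absval ((\<beta> j - u) * coeff g k)) * r ^ k"
    unfolding coeff_linear_mult using assms(2) by (intro mult_right_mono absval_diff_le_max) auto
  also have "\<dots> \<le> r * M" using 1 2 by (simp add: max_def)
  finally show ?case
    unfolding eq using insert.hyps by (simp add: M_def ac_simps)
qed

section \<open>Comparing roots with roots of the derivative\<close>

text \<open>The last hypothesis says that the term of index \<open>n\<close> is maximal in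
  \<open>z g'(z)\<close>. In \<open>g'\<close> this is index \<open>n - 1\<close>, and the leftmost
  maximal index cannot lie to its right.\<close>

lemma dominant_pderiv_less:
  fixes g :: "'a::nonarch_valued_field poly"
  assumes "0 < t" "0 < n" "dominant t m (pderiv g)"
    and "\<And>i. absval (of_nat i * coeff g i) * t ^ i \<le> absval (of_nat n * coeff g n) * t ^ n"
  shows "m < n"
proof (rule ccontr)
  assume "\<not> m < n"
  then have "n - 1 < m" using assms(2) by simp
  then have "absval (of_nat n * coeff g n) * t ^ (n - 1)
      < absval (of_nat (Suc m) * coeff g (Suc m)) * t ^ m"
    using assms(2,3) unfolding dominant_def coeff_pderiv by (metis Suc_pred')
  then have "absval (of_nat n * coeff g n) * t ^ (n - 1) * t
      < absval (of_nat (Suc m) * coeff g (Suc m)) * t ^ m * t"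
    using assms(1) by simp
  then show False
    using assms(4)[of "Suc m"] assms(2) by (simp add: mult.assoc power_Suc2[symmetric])
qed

text \<open>
  By the ultrametric inequality, being at distance less than \<open>t\<close> is an equivalence relation.
\<close>

lemma card_clusters_le:
  fixes \<beta> :: "'b \<Rightarrow> 'a::nonarch_valued_field" and c :: "'c \<Rightarrow> 'a"
  assumes fin: "finite I" "finite J" and t: "0 < t"
    and cover: "\<And>i. i \<in> I \<Longrightarrow> \<exists>j\<in>J. absval (c i - \<beta> j) < t"
    and less: "\<And>j. j \<in> J \<Longrightarrow> card {i\<in>I. absval (c i - \<beta> j) < t} < card {k\<in>J. absval (\<beta> k - \<beta> j) < t}"
  shows "card I + card ((\<lambda>j. {k\<in>J. absval (\<beta> k - \<beta> j) < t}) ` J) \<le> card J"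
proof -
  define cl where "cl j = {k\<in>J. absval (\<beta> k - \<beta> j) < t}" for j
  have trans: "absval (x - z) < t" if "absval (x - y) < t" "absval (y - z) < t" for x y z :: 'a
    using that absval_diff_trans[of x z y] by simp
  have sym: "absval (y - x) < t" if "absval (x - y) < t" for x y :: 'a
    using that absval_minus_commute[of x y] by simp
  have cl_eq: "cl j = cl k" if "absval (\<beta> k - \<beta> j) < t" for j k
    unfolding cl_def using trans[OF _ that] trans[OF _ sym[OF that]] by (intro Collect_cong) metis
  \<comment> \<open>Each point of \<open>I\<close> is attached to a cluster, every cluster has at
    least one more member than attached points, and the clusters partition \<open>J\<close>. Summing
    gives one surplus per cluster.\<close>
  define near where "near X = {i\<in>I. \<exists>k\<in>X. absval (c i - \<beta> k) < t}" for X
  have near_cl: "near (cl j) = {i\<in>I. absval (c i - \<beta> j) < t}" if "j \<in> J" for j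
  proof -
    have "j \<in> cl j" using that t by (simp add: cl_def)
    moreover have "absval (c i - \<beta> j) < t" if "k \<in> cl j" "absval (c i - \<beta> k) < t" for i k
      using that trans[of "c i" "\<beta> k" "\<beta> j"] by (simp add: cl_def)
    ultimately show ?thesis unfolding near_def by blast
  qed
  have "I = (\<Union>X\<in>cl ` J. near X)"
  proof -
    have "i \<in> (\<Union>X\<in>cl ` J. near X)" if i: "i \<in> I" for i
    proof -
      obtain j where j: "j \<in> J" "absval (c i - \<beta> j) < t" using cover i by blast
      then have "i \<in> near (cl j)" using near_cl i by simp
      then show ?thesis using j by blast
    qed
    then show ?thesis by (auto simp: near_def)
  qed
  then have "card I \<le> (\<Sum>X\<in>cl ` J. card (near X))"
    using card_UN_le[of "cl ` J" near] fin by simp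
  then have "card I + card (cl ` J) \<le> (\<Sum>X\<in>cl ` J. card (near X) + 1)"
    unfolding sum.distrib card_eq_sum by simp
  also have "\<dots> \<le> (\<Sum>X\<in>cl ` J. card X)"
    using less near_cl by (intro sum_mono) (auto simp: cl_def Suc_le_eq)
  also have "\<dots> = card (\<Union> (cl ` J))"
  proof (rule card_Union_disjoint[symmetric])
    have "cl j = cl k" if "l \<in> cl j" "l \<in> cl k" for j k l
    proof -
      have "absval (\<beta> l - \<beta> j) < t" "absval (\<beta> l - \<beta> k) < t" using that by (auto simp: cl_def)
      then show ?thesis using cl_eq by metis
    qed
    then show "pairwise disjnt (cl ` J)" unfolding pairwise_def disjnt_def by blast
    show "finite X" if "X \<in> cl ` J" for X using that fin by (auto simp: cl_def)
  qed
  also have "\<Union> (cl ` J) = J"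
    using t by (auto simp: cl_def)
  finally show ?thesis by (simp add: cl_def[abs_def])
qed

lemma card_less_of_clusters:
  fixes \<beta> :: "'b \<Rightarrow> 'a::nonarch_valued_field" and c :: "'c \<Rightarrow> 'a"
  assumes "finite I" "finite J" "0 < t" "J \<noteq> {}"
    and "\<And>i. i \<in> I \<Longrightarrow> \<exists>j\<in>J. absval (c i - \<beta> j) < t"
    and "\<And>j. j \<in> J \<Longrightarrow> card {i\<in>I. absval (c i - \<beta> j) < t} < card {k\<in>J. absval (\<beta> k - \<beta> j) < t}"
  shows "card I < card J"
proof -
  have "0 < card ((\<lambda>j. {k\<in>J. absval (\<beta> k - \<beta> j) < t}) ` J)"
    using assms(2,4) by (simp add: card_gt_0_iff)
  then show ?thesis
    using card_clusters_le[of I J t c \<beta>, OF assms(1-3,5,6)] by linarith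
qed

text \<open>Two members at distance at least \<open>t\<close> lie in different clusters, so the
  surplus of one occurs at least twice.\<close>

lemma card_Suc_less_of_two_clusters:
  fixes \<beta> :: "'b \<Rightarrow> 'a::nonarch_valued_field" and c :: "'c \<Rightarrow> 'a"
  assumes "finite I" "finite J" "0 < t" "j \<in> J" "k \<in> J" "t \<le> absval (\<beta> j - \<beta> k)"
    and "\<And>i. i \<in> I \<Longrightarrow> \<exists>j\<in>J. absval (c i - \<beta> j) < t"
    and "\<And>j. j \<in> J \<Longrightarrow> card {i\<in>I. absval (c i - \<beta> j) < t} < card {k\<in>J. absval (\<beta> k - \<beta> j) < t}"
  shows "Suc (card I) < card J"
proof -
  define cl where "cl j = {k\<in>J. absval (\<beta> k - \<beta> j) < t}" for j
  have "j \<in> cl j" "j \<notin> cl k"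
    using assms(3-6) by (auto simp: cl_def)
  then have "cl j \<noteq> cl k" by blast
  then have "card {cl j, cl k} = 2" by simp
  moreover have "card {cl j, cl k} \<le> card (cl ` J)"
    using assms by (intro card_mono) auto
  ultimately show ?thesis
    using card_clusters_le[of I J t c \<beta>, OF assms(1-3,7,8)] by (simp add: cl_def[abs_def])
qed

section \<open>Roots and critical points\<close>

lemma absval_of_nat_not_dvd:
  assumes "prime p" "absval (of_nat p :: 'a::nonarch_valued_field) = 1 / real p" "\<not> p dvd n"
  shows "absval (of_nat n :: 'a) = 1"
proof (rule absval_of_nat_coprime)
  show "coprime n p" using assms(1,3) prime_imp_coprime coprime_commute by blast
  show "absval (of_nat p :: 'a) < 1" using assms(2) prime_gt_1_nat[OF assms(1)] by simp
qed

lemma not_dvd_below_double: "0 < n \<Longrightarrow> n < 2 * p \<Longrightarrow> n \<noteq> p \<Longrightarrow> \<not> p dvd (n :: nat)"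
  by (auto simp: dvd_def)

text \<open>Enumerating by indices counts roots and critical points with multiplicity, so
  cardinalities of index sets are the counts seen by the Newton polygon.\<close>

locale split_poly =
  fixes f :: "'a::nonarch_valued_field poly" and d :: nat and \<beta> c :: "nat \<Rightarrow> 'a"
  assumes d: "2 \<le> d"
    and f_eq: "f = (\<Prod>j<d. [:- \<beta> j, 1:])"
    and deriv_eq: "pderiv f = smult (of_nat d) (\<Prod>i<d - 1. [:- c i, 1:])"
begin

abbreviation shift :: "'a \<Rightarrow> 'a poly" where "shift u \<equiv> pcompose f [:u, 1:]"

lemma degree_f: "degree f = d"
  by (simp add: f_eq degree_prod_linear)

lemma coeff_shift_d: "coeff (shift u) d = 1"
proof -
  have "lead_coeff f = 1"
    using lead_coeff_prod_linear[of \<beta> "{..<d}"] by (simp add: f_eq degree_prod_linear)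
  moreover have "degree (shift u) = d" by (simp add: degree_pcompose degree_f)
  ultimately show ?thesis
    using lead_coeff_comp[of "[:u, 1:]" f] by simp
qed

lemma pderiv_shift: "pderiv (shift u) = pcompose (smult (of_nat d) (\<Prod>i<d - 1. [:- c i, 1:])) [:u, 1:]"
  by (simp add: pderiv_pcompose deriv_eq pderiv_pCons)

lemma absval_poly_f: "absval (poly f x) = (\<Prod>j<d. absval (x - \<beta> j))"
  by (simp add: f_eq poly_prod absval_prod)

lemma dominant_shift: "0 < t \<Longrightarrow> dominant t (card {j\<in>{..<d}. absval (\<beta> j - u) < t}) (shift u)"
  using dominant_split[of "{..<d}" t 1 \<beta> u] by (simp add: f_eq)

lemma dominant_pderiv_shift:
  "0 < t \<Longrightarrow> dominant t (card {i\<in>{..<d - 1}. absval (c i - u) < t}) (pderiv (shift u))"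
  unfolding pderiv_shift using d by (intro dominant_split) auto

text \<open>The comparison of terms stays a hypothesis because it has two sources: \<open>n\<close>
  being a unit, or, for degree \<open>2 * p\<close>, the factor \<open>d\<close> in the
  derivative.\<close>

lemma card_crit_less:
  assumes "0 < t" and n: "n = card {j\<in>{..<d}. absval (\<beta> j - u) < t}" "0 < n"
    and "\<And>i. absval (of_nat i * coeff (shift u) i) * t ^ i
           \<le> absval (of_nat n * coeff (shift u) n) * t ^ n"
  shows "card {i\<in>{..<d - 1}. absval (c i - u) < t} < n"
  using dominant_pderiv_less[OF assms(1) n(2) dominant_pderiv_shift[OF assms(1)] assms(4)] .

text \<open>Differentiation multiplies the term of index \<open>i\<close> by an integer of absolute
  value at most 1, and by a unit at \<open>n\<close>, so \<open>n\<close> stays maximal.\<close>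

lemma card_crit_less_tame:
  assumes "0 < t" and n: "n = card {j\<in>{..<d}. absval (\<beta> j - u) < t}" "absval (of_nat n :: 'a) = 1"
  shows "card {i\<in>{..<d - 1}. absval (c i - u) < t} < n"
proof (rule card_crit_less[OF assms(1) n(1)])
  show "0 < n" using n(2) by (cases n) auto
  show "absval (of_nat i * coeff (shift u) i) * t ^ i
      \<le> absval (of_nat n * coeff (shift u) n) * t ^ n" for i
  proof -
    have "absval (of_nat i * coeff (shift u) i) * t ^ i \<le> absval (coeff (shift u) i) * t ^ i"
      using assms(1) by (intro mult_right_mono) (auto simp: absval_mult mult_left_le_one_le absval_of_nat_le_1)
    also have "\<dots> \<le> absval (coeff (shift u) n) * t ^ n"
      using dominant_shift[OF assms(1), of u] unfolding n(1) dominant_def by blast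
    finally show ?thesis using n(2) by (simp add: absval_mult)
  qed
qed

text \<open>With all critical points within \<open>r\<close> of \<open>u\<close>, the derivative has
  Gauss norm at most \<open>absval (of_nat d) * r ^ (d - 1)\<close>; one more factor
  \<open>r\<close> passes from index \<open>k - 1\<close> of the derivative to index
  \<open>k\<close>.\<close>

lemma coeff_shift_bound:
  assumes "0 < r" "\<And>i. i < d - 1 \<Longrightarrow> absval (c i - u) \<le> r"
  shows "absval (of_nat k * coeff (shift u) k) * r ^ k \<le> absval (of_nat d :: 'a) * r ^ d"
proof (cases k)
  case 0
  then show ?thesis using assms(1) by simp
next
  case (Suc l)
  have "absval (coeff (pderiv (shift u)) l) * r ^ l \<le> absval (of_nat d :: 'a) * r ^ card {..<d - 1}"
    unfolding pderiv_shift using assms by (intro coeff_split_bound) auto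
  then have "absval (coeff (pderiv (shift u)) l) * r ^ l * r \<le> absval (of_nat d :: 'a) * r ^ (d - 1) * r"
    using assms(1) by simp
  then show ?thesis
    using d by (simp add: Suc coeff_pderiv mult.assoc power_Suc2[symmetric] del: of_nat_Suc power_Suc)
qed

section \<open>Escaping orbits and the size of the roots\<close>

text \<open>Outside a disc of radius at least 1 containing all roots, \<open>f\<close> raises
  absolute values to the power \<open>d\<close>, so the orbit escapes.\<close>

lemma bounded_orbit_imp_le:
  assumes "1 \<le> R" "\<And>j. j < d \<Longrightarrow> absval (\<beta> j) \<le> R" "bounded (range (\<lambda>n. (poly f ^^ n) z))"
  shows "absval z \<le> R"
proof (rule ccontr)
  assume "\<not> absval z \<le> R"
  then have z: "R < absval z" by simp
  have grow: "absval (poly f x) = absval x ^ d" if "R < absval x" for x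
  proof -
    have "absval (x - \<beta> j) = absval x" if "j < d" for j
      using assms(2)[OF that] \<open>R < absval x\<close> absval_add_eq_right[of "- \<beta> j" x] by simp
    then show ?thesis by (simp add: absval_poly_f)
  qed
  \<comment> \<open>The true growth is doubly exponential; gaining one factor
    \<open>absval z\<close> per iterate suffices.\<close>
  have orbit: "absval z ^ Suc n \<le> absval ((poly f ^^ n) z)" for n
  proof (induction n)
    case (Suc n)
    let ?x = "(poly f ^^ n) z"
    have "absval z ^ 1 \<le> absval z ^ Suc n" using z assms(1) by (intro power_increasing) auto
    then have x: "absval z \<le> absval ?x" using Suc by simp
    have "absval z ^ Suc (Suc n) \<le> absval ?x * absval ?x"
      unfolding power_Suc[of _ "Suc n"] using x Suc by (intro mult_mono) auto
    also have "\<dots> = absval ?x ^ 2" by (simp add: power2_eq_square)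
    also have "\<dots> \<le> absval ?x ^ d" using x z assms(1) d by (intro power_increasing) auto
    also have "\<dots> = absval (poly f ?x)" using grow[of ?x] x z by simp
    finally show ?case by simp
  qed auto
  obtain M where M: "\<And>n. dist 0 ((poly f ^^ n) z) \<le> M"
    using assms(3) bounded_any_center[of "range (\<lambda>n. (poly f ^^ n) z)" 0] by auto
  obtain n where "M < absval z ^ n"
    using real_arch_pow[of "absval z" M] z assms(1) by auto
  also have "\<dots> \<le> absval z ^ Suc n" using z assms(1) by (intro power_increasing) auto
  also have "\<dots> \<le> absval ((poly f ^^ n) z)" by (rule orbit)
  also have "\<dots> = dist 0 ((poly f ^^ n) z)" by (simp add: dist_absval)
  finally show False using M[of n] by simp
qed

text \<open>
  If some root were larger than all critical points, the Newton polygon would single out an exponent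
  \<open>q\<close> whose term dominates at the largest critical point, and the critical value would escape.
\<close>

lemma root_le_crit:
  assumes r: "1 < r" "\<And>i. i < d - 1 \<Longrightarrow> absval (c i) \<le> r" "i0 < d - 1" "absval (c i0) = r"
    and j0: "j0 < d" "\<beta> j0 = 0"
    and q: "\<And>n. 0 < n \<Longrightarrow> n < d \<Longrightarrow> n \<noteq> q \<Longrightarrow> absval (of_nat d :: 'a) \<le> absval (of_nat n :: 'a)"
    and orbit: "bounded (range (\<lambda>n. (poly f ^^ n) (poly f (c i0))))"
    and "j < d"
  shows "absval (\<beta> j) \<le> r"
proof (rule ccontr)
  assume contra: "\<not> absval (\<beta> j) \<le> r"
  define R where "R = Max ((\<lambda>j. absval (\<beta> j)) ` {..<d})"
  have R: "absval (\<beta> j) \<le> R" if "j < d" for j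
    unfolding R_def using that by (intro Max_ge) auto
  have "R \<in> (\<lambda>j. absval (\<beta> j)) ` {..<d}"
    unfolding R_def using j0(1) by (intro Max_in) (auto simp: lessThan_empty_iff)
  then obtain j1 where j1: "j1 < d" "absval (\<beta> j1) = R" by auto
  have rR: "r < R" using contra R[OF \<open>j < d\<close>] by simp
  have shift0: "shift 0 = f" by (rule pcompose_idR)
  have fd: "coeff f d = 1" using coeff_shift_d[of 0] unfolding shift0 .
  \<comment> \<open>At radius \<open>R\<close>, where the largest roots lie, \<open>f\<close> has
    dominant index \<open>n < d\<close>, while its derivative, whose roots are all smaller than
    \<open>R\<close>, has dominant index \<open>d - 1\<close>. Comparing the terms \<open>n\<close>
    and \<open>d\<close> forces \<open>absval (of_nat n) < absval (of_nat d)\<close>, hence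
    \<open>n = q\<close>.\<close>
  define n where "n = card {j\<in>{..<d}. absval (\<beta> j - 0) < R}"
  have "{j\<in>{..<d}. absval (\<beta> j - 0) < R} \<subset> {..<d}" using j1 by auto
  then have "n < card {..<d}" unfolding n_def by (intro psubset_card_mono) auto
  then have nd: "n < d" by simp
  have d0: "0 < d" using d by simp
  have "j0 \<in> {j\<in>{..<d}. absval (\<beta> j - 0) < R}" using j0 rR r(1) by simp
  then have n0: "0 < n" unfolding n_def by (subst card_gt_0_iff) auto
  have nd1: "n - 1 < d - 1" using n0 nd by simp
  have "dominant R n f" using dominant_shift[of R 0] rR r(1) unfolding shift0 n_def by simp
  then have "absval (coeff f d) * R ^ d \<le> absval (coeff f n) * R ^ n"
    unfolding dominant_def by blast
  then have an: "R ^ d \<le> absval (coeff f n) * R ^ n"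
    using fd by simp
  have "{i\<in>{..<d - 1}. absval (c i - 0) < R} = {..<d - 1}"
  proof -
    have "absval (c i - 0) < R" if "i < d - 1" for i using r(2)[OF that] rR by simp
    then show ?thesis by blast
  qed
  then have "dominant R (d - 1) (pderiv f)"
    using dominant_pderiv_shift[of R 0] rR r(1) unfolding shift0 by simp
  then have "absval (coeff (pderiv f) (n - 1)) * R ^ (n - 1) < absval (coeff (pderiv f) (d - 1)) * R ^ (d - 1)"
    using nd1 unfolding dominant_def by blast
  then have "absval (of_nat n * coeff f n) * R ^ (n - 1) < absval (of_nat d * coeff f d) * R ^ (d - 1)"
    using n0 d by (simp add: coeff_pderiv del: of_nat_Suc)
  then have "absval (of_nat n * coeff f n) * R ^ (n - 1) * R < absval (of_nat d * coeff f d) * R ^ (d - 1) * R"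
    using rR r(1) by simp
  then have "absval (of_nat n :: 'a) * (absval (coeff f n) * R ^ n) < absval (of_nat d :: 'a) * R ^ d"
    unfolding mult.assoc power_minus_mult[OF n0] power_minus_mult[OF d0] fd
    by (simp add: absval_mult mult.assoc)
  moreover have "absval (of_nat n :: 'a) * R ^ d \<le> absval (of_nat n :: 'a) * (absval (coeff f n) * R ^ n)"
    using an by (intro mult_left_mono) auto
  ultimately have "absval (of_nat n :: 'a) * R ^ d < absval (of_nat d :: 'a) * R ^ d" by simp
  then have "absval (of_nat n :: 'a) < absval (of_nat d :: 'a)"
    using rR r(1) by simp
  then have nq: "n = q" using q[OF n0 nd] by force
  have pow: "x ^ (d - n) * x ^ n = x ^ d" for x :: real
    using nd by (simp flip: power_add)
  have "R ^ (d - n) * R ^ n \<le> absval (coeff f n) * R ^ n"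
    unfolding pow by (rule an)
  then have "R ^ (d - n) \<le> absval (coeff f n)"
    using rR r(1) by simp
  then have big: "R ^ (d - n) * r ^ n \<le> absval (coeff f n) * r ^ n"
    using r(1) by simp
  \<comment> \<open>Shrinking the radius from \<open>R\<close> to \<open>r\<close> favours the lower
    exponent \<open>n\<close>, so its term also beats the term of index \<open>d\<close> at the
    critical point.\<close>
  have "r ^ d = r ^ (d - n) * r ^ n" by (rule pow[symmetric])
  also have "\<dots> < R ^ (d - n) * r ^ n"
    using rR r(1) nd by (intro mult_strict_right_mono power_strict_mono) auto
  finally have rd: "r ^ d < absval (coeff f n) * r ^ n" using big by simp
  \<comment> \<open>The remaining terms are controlled by the derivative: \<open>i\<close> times the
    coefficient is bounded through \<open>coeff_shift_bound\<close>, and \<open>i \<noteq> q\<close>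
    allows division by \<open>i\<close>.\<close>
  have small: "absval (coeff f i) * r ^ i \<le> r ^ d" if "i \<le> d" "i \<noteq> n" for i
  proof -
    consider "i = 0" | "i = d" | "0 < i" "i < d" using \<open>i \<le> d\<close> by linarith
    then show ?thesis
    proof cases
      case 1
      have "poly f 0 = 0" using j0 by (auto simp: f_eq poly_prod)
      then show ?thesis using 1 r(1) by (simp add: poly_0_coeff_0)
    next
      case 2
      then show ?thesis using fd by simp
    next
      case 3
      have "absval (of_nat d :: 'a) * (absval (coeff f i) * r ^ i)
          \<le> absval (of_nat i :: 'a) * (absval (coeff f i) * r ^ i)"
        using q[of i] 3 nq that r(1) by (intro mult_right_mono) auto
      also have "\<dots> \<le> absval (of_nat d :: 'a) * r ^ d"
        using coeff_shift_bound[of r 0 i] r unfolding shift0 by (simp add: absval_mult mult.assoc)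
      finally show ?thesis using d by simp
    qed
  qed
  have "poly f (c i0) = (\<Sum>i\<in>{..d} - {n}. coeff f i * c i0 ^ i) + coeff f n * c i0 ^ n"
    unfolding poly_altdef degree_f using nd by (subst sum.remove[of _ n]) auto
  moreover have "absval (\<Sum>i\<in>{..d} - {n}. coeff f i * c i0 ^ i) \<le> r ^ d"
    using small r by (intro absval_sum_le) (auto simp: absval_mult)
  moreover have "absval (coeff f n * c i0 ^ n) = absval (coeff f n) * r ^ n"
    using r by (simp add: absval_mult)
  ultimately have "absval (poly f (c i0)) = absval (coeff f n) * r ^ n"
    using rd by (simp add: absval_add_eq_right)
  moreover have "absval (poly f (c i0)) \<le> R"
    by (rule bounded_orbit_imp_le[OF _ R orbit]) (use rR r(1) in linarith)
  \<comment> \<open>The critical value thus leaves the disc of radius \<open>R\<close> that holds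
    all roots, although its orbit is bounded.\<close>
  moreover have "R < R ^ (d - n) * r ^ n"
  proof -
    have "R * 1 < R * r ^ n"
      using rR r(1) n0 by (intro mult_strict_left_mono one_less_power) auto
    also have "R ^ 1 \<le> R ^ (d - n)"
      using rR r(1) nd by (intro power_increasing) auto
    then have "R * r ^ n \<le> R ^ (d - n) * r ^ n"
      using r(1) by (intro mult_right_mono) auto
    finally show ?thesis by simp
  qed
  ultimately show False using big by linarith
qed

section \<open>Lower bounds for the largest critical value\<close>

lemma crit_near_root:
  assumes "0 \<le> t" "absval (poly f x) < t ^ d"
  shows "\<exists>j\<in>{..<d}. absval (x - \<beta> j) < t"
  using prod_less_imp_factor_less[of "\<lambda>j. absval (x - \<beta> j)" "{..<d}" t] assms
  by (simp add: absval_poly_f)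

text \<open>A root closer than \<open>r\<close> to a critical point of size \<open>r\<close> cannot
  be smaller than \<open>r\<close>. Together with the root 0 this yields two clusters.\<close>

lemma far_root:
  assumes r: "0 < r" "i0 < d - 1" "absval (c i0) = r" "absval (poly f (c i0)) < r ^ d"
  shows "\<exists>j<d. r \<le> absval (\<beta> j)"
proof -
  obtain j where j: "j < d" "absval (c i0 - \<beta> j) < r"
    using crit_near_root[of r "c i0"] r by auto
  have "absval (c i0) \<le> max (absval (c i0 - \<beta> j)) (absval (\<beta> j))"
    using absval_add_le_max[of "c i0 - \<beta> j" "\<beta> j"] by simp
  then have "r \<le> absval (\<beta> j)" using j(2) r(3) by linarith
  with j(1) show ?thesis by blast
qed

lemma critical_value_large_degree_double:
  assumes p: "prime p" "absval (of_nat p :: 'a) = 1 / real p" "d = 2 * p"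
    and r: "0 < r" "\<And>j. j < d \<Longrightarrow> absval (\<beta> j) \<le> r" "\<And>i. i < d - 1 \<Longrightarrow> absval (c i) \<le> r"
      "i0 < d - 1" "absval (c i0) = r"
    and j0: "j0 < d" "\<beta> j0 = 0"
  shows "\<exists>i<d - 1. r ^ d \<le> absval (poly f (c i))"
proof (rule ccontr)
  assume contra: "\<not> ?thesis"
  then have small: "absval (poly f (c i)) < r ^ d" if "i < d - 1" for i
    using that by (meson not_le)
  obtain j1 where j1: "j1 < d" "r \<le> absval (\<beta> j1)"
    using far_root[OF r(1,4,5) small[OF r(4)]] by blast
  have "Suc (card {..<d - 1}) < card {..<d}"
  proof (rule card_Suc_less_of_two_clusters[of _ _ r j1 j0 \<beta> c])
    show "r \<le> absval (\<beta> j1 - \<beta> j0)" using j1 j0 by simp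
    show "\<exists>j\<in>{..<d}. absval (c i - \<beta> j) < r" if "i \<in> {..<d - 1}" for i
      using crit_near_root[of r "c i"] small that r(1) by simp
    fix j assume j: "j \<in> {..<d}"
    define n where "n = card {k \<in> {..<d}. absval (\<beta> k - \<beta> j) < r}"
    have "j \<in> {k \<in> {..<d}. absval (\<beta> k - \<beta> j) < r}" using j r(1) by simp
    then have n0: "0 < n" unfolding n_def by (subst card_gt_0_iff) auto
    \<comment> \<open>The root 0 and the far root are never in the same cluster, so every cluster
      has fewer than \<open>2 * p\<close> members.\<close>
    have "j0 \<notin> {k \<in> {..<d}. absval (\<beta> k - \<beta> j) < r} \<or> j1 \<notin> {k \<in> {..<d}. absval (\<beta> k - \<beta> j) < r}"
      using absval_diff_trans[of "\<beta> j1" "\<beta> j0" "\<beta> j"] absval_minus_commute[of "\<beta> j" "\<beta> j0"] j1 j0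
      by auto
    then have "{k \<in> {..<d}. absval (\<beta> k - \<beta> j) < r} \<subset> {..<d}" using j1(1) j0(1) by blast
    then have "n < card {..<d}" unfolding n_def by (intro psubset_card_mono) auto
    then have nd: "n < 2 * p" using p(3) by simp
    \<comment> \<open>Here \<open>d = 2 * p\<close> enters: a cluster size is either a unit or equal
      to \<open>p\<close>, and \<open>p\<close> divides \<open>d\<close>.\<close>
    have dn: "absval (of_nat d :: 'a) \<le> absval (of_nat n :: 'a)"
    proof (cases "p dvd n")
      case True
      then obtain m where m: "n = p * m" by blast
      with n0 nd have "m = 1" by (cases m) auto
      then show ?thesis using m p(3) absval_of_nat_mono_dvd[of p d] by simp
    next
      case False
      then show ?thesis using absval_of_nat_not_dvd[OF p(1,2)] absval_of_nat_le_1[of d] by simp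
    qed
    have "absval (coeff (shift (\<beta> j)) d) * r ^ d \<le> absval (coeff (shift (\<beta> j)) n) * r ^ n"
      using dominant_shift[OF r(1), of "\<beta> j"] unfolding n_def dominant_def by blast
    then have gn: "r ^ d \<le> absval (coeff (shift (\<beta> j)) n) * r ^ n"
      unfolding coeff_shift_d by simp
    have "card {i \<in> {..<d - 1}. absval (c i - \<beta> j) < r} < n"
    proof (rule card_crit_less[OF r(1) n_def n0])
      fix i
      have "absval (of_nat i * coeff (shift (\<beta> j)) i) * r ^ i \<le> absval (of_nat d :: 'a) * r ^ d"
      proof (rule coeff_shift_bound[OF r(1)])
        fix k assume "k < d - 1"
        then show "absval (c k - \<beta> j) \<le> r"
          using r(2)[of j] r(3)[of k] j absval_diff_le_max[of "c k" "\<beta> j"] by simp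
      qed
      also have "\<dots> \<le> absval (of_nat n :: 'a) * (absval (coeff (shift (\<beta> j)) n) * r ^ n)"
        using dn gn r(1) by (intro mult_mono) auto
      finally show "absval (of_nat i * coeff (shift (\<beta> j)) i) * r ^ i
          \<le> absval (of_nat n * coeff (shift (\<beta> j)) n) * r ^ n"
        by (simp add: absval_mult mult.assoc)
    qed
    then show "card {i \<in> {..<d - 1}. absval (c i - \<beta> j) < r}
        < card {k \<in> {..<d}. absval (\<beta> k - \<beta> j) < r}"
      unfolding n_def .
  qed (use r j1 j0 in auto)
  then show False using d by simp
qed

lemma critical_value_large:
  assumes p: "prime p" "absval (of_nat p :: 'a) = 1 / real p" "p < d" "d < 2 * p"
    and r: "0 < r" "\<And>j. j < d \<Longrightarrow> absval (\<beta> j) \<le> r" "\<And>i. i < d - 1 \<Longrightarrow> absval (c i) \<le> r"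
      "i0 < d - 1" "absval (c i0) = r"
    and j0: "j0 < d" "\<beta> j0 = 0"
  shows "\<exists>i<d - 1. r ^ d / real p ^ p \<le> absval (poly f (c i))"
proof (rule ccontr)
  assume contra: "\<not> ?thesis"
  then have small': "absval (poly f (c i)) < r ^ d / real p ^ p" if "i < d - 1" for i
    using that by (meson not_le)
  have p1: "1 < p" using prime_gt_1_nat[OF p(1)] .
  have "r ^ d / real p ^ p \<le> r ^ d / 1"
    using r(1) p1 by (intro divide_left_mono one_le_power) auto
  then have small: "absval (poly f (c i)) < r ^ d" if "i < d - 1" for i
    using small'[OF that] by simp
  have near: "\<exists>j\<in>{..<d}. absval (c i - \<beta> j) < r" if "i < d - 1" for i
    using crit_near_root[of r "c i"] small that r(1) by simp
  have less_trans: "absval (x - z) < t" if "absval (x - y) < t" "absval (y - z) < t" for x y z :: 'a and t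
    using that absval_diff_trans[of x z y] by simp
  have less_sym: "absval (y - x) < t" if "absval (x - y) < t" for x y :: 'a and t
    using that absval_minus_commute[of x y] by simp
  obtain j1 where j1: "j1 < d" "r \<le> absval (\<beta> j1)"
    using far_root[OF r(1,4,5) small[OF r(4)]] by blast
  have tame: "card {i \<in> {..<d - 1}. absval (c i - \<beta> j) < t} < card {k \<in> {..<d}. absval (\<beta> k - \<beta> j) < t}"
    if "0 < t" "\<not> p dvd card {k \<in> {..<d}. absval (\<beta> k - \<beta> j) < t}" for j t
    using card_crit_less_tame[OF that(1) refl] absval_of_nat_not_dvd[OF p(1,2) that(2)] by blast
  \<comment> \<open>If every cluster size were prime to \<open>p\<close>, all clusters would be
    tame, and two clusters would leave room for fewer than \<open>d - 1\<close> critical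
    points.\<close>
  have "\<exists>j<d. p dvd card {k \<in> {..<d}. absval (\<beta> k - \<beta> j) < r}"
  proof (rule ccontr)
    assume none: "\<not> ?thesis"
    have "Suc (card {..<d - 1}) < card {..<d}"
    proof (rule card_Suc_less_of_two_clusters[of _ _ r j1 j0 \<beta> c])
      show "r \<le> absval (\<beta> j1 - \<beta> j0)" using j1 j0 by simp
      show "\<exists>j\<in>{..<d}. absval (c i - \<beta> j) < r" if "i \<in> {..<d - 1}" for i
        using near that by simp
      show "card {i \<in> {..<d - 1}. absval (c i - \<beta> j) < r} < card {k \<in> {..<d}. absval (\<beta> k - \<beta> j) < r}"
        if "j \<in> {..<d}" for j
        using none that by (intro tame[OF r(1)]) blast
    qed (use r j1 j0 in auto)
    then show False using d by simp
  qed
  then obtain j2 where j2: "j2 < d" "p dvd card {k \<in> {..<d}. absval (\<beta> k - \<beta> j2) < r}" by blast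
  define K where "K = {k \<in> {..<d}. absval (\<beta> k - \<beta> j2) < r}"
  define C where "C = {i \<in> {..<d - 1}. absval (c i - \<beta> j2) < r}"
  have fin: "finite K" "finite C" by (auto simp: K_def C_def)
  have "j2 \<in> K" using j2(1) r(1) by (simp add: K_def)
  have "card K \<le> card {..<d}" unfolding K_def by (intro card_mono) auto
  then have "card K < 2 * p" using p(4) by simp
  moreover obtain m where m: "card K = p * m" using j2(2) unfolding K_def by blast
  moreover have "card K \<noteq> 0" using fin \<open>j2 \<in> K\<close> by auto
  ultimately have "m = 1" by (cases m) auto
  with m have card_K: "card K = p" by simp
  have KJ: "K \<subseteq> {..<d}" and CI: "C \<subseteq> {..<d - 1}" by (auto simp: K_def C_def)
  have card_rest: "card ({..<d} - K) = d - p"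
    using card_Diff_subset[OF fin(1) KJ] card_K by simp
  \<comment> \<open>Outside \<open>K\<close> only \<open>d - p < p\<close> roots remain, so all
    clusters there are tame and hold at most \<open>d - p - 1\<close> critical points. At least
    \<open>p\<close> of the \<open>d - 1\<close> are therefore left for \<open>C\<close>.\<close>
  have "card ({..<d - 1} - C) < card ({..<d} - K)"
  proof (rule card_less_of_clusters[of _ _ r c \<beta>])
    show "{..<d} - K \<noteq> {}" using card_rest p(3) by (metis card.empty less_numeral_extra(3) zero_less_diff)
    show "\<exists>j\<in>{..<d} - K. absval (c i - \<beta> j) < r" if i: "i \<in> {..<d - 1} - C" for i
    proof -
      obtain j where j: "j \<in> {..<d}" "absval (c i - \<beta> j) < r" using near[of i] i by auto
      moreover have "j \<notin> K"
        using i less_trans[OF j(2), of "\<beta> j2"] by (auto simp: C_def K_def)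
      ultimately show ?thesis by blast
    qed
    fix j assume j: "j \<in> {..<d} - K"
    have eq: "{k \<in> {..<d} - K. absval (\<beta> k - \<beta> j) < r} = {k \<in> {..<d}. absval (\<beta> k - \<beta> j) < r}"
    proof -
      have "k \<notin> K" if "absval (\<beta> k - \<beta> j) < r" for k
        using j less_trans[OF less_sym[OF that], of "\<beta> j2"] by (auto simp: K_def)
      then show ?thesis by blast
    qed
    have "card {k \<in> {..<d} - K. absval (\<beta> k - \<beta> j) < r} \<le> d - p"
      unfolding card_rest[symmetric] by (intro card_mono) auto
    moreover have "j \<in> {k \<in> {..<d} - K. absval (\<beta> k - \<beta> j) < r}" using j r(1) by simp
    then have "0 < card {k \<in> {..<d} - K. absval (\<beta> k - \<beta> j) < r}"
      by (subst card_gt_0_iff) auto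
    ultimately have "\<not> p dvd card {k \<in> {..<d}. absval (\<beta> k - \<beta> j) < r}"
      unfolding eq using p(3,4) by (intro nat_dvd_not_less) auto
    then have "card {i \<in> {..<d - 1}. absval (c i - \<beta> j) < r} < card {k \<in> {..<d} - K. absval (\<beta> k - \<beta> j) < r}"
      unfolding eq by (rule tame[OF r(1)])
    moreover have "card {i \<in> {..<d - 1} - C. absval (c i - \<beta> j) < r}
        \<le> card {i \<in> {..<d - 1}. absval (c i - \<beta> j) < r}" by (intro card_mono) auto
    ultimately show "card {i \<in> {..<d - 1} - C. absval (c i - \<beta> j) < r}
        < card {k \<in> {..<d} - K. absval (\<beta> k - \<beta> j) < r}" by linarith
  qed (use r in auto)
  moreover have "card ({..<d - 1} - C) = d - 1 - card C"
    using card_Diff_subset[OF fin(2) CI] by simp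
  ultimately have card_C: "p \<le> card C"
    using card_rest p(3) by linarith

  \<comment> \<open>Roots outside \<open>K\<close> are at distance at least \<open>r\<close> from a
    critical point in \<open>C\<close>. Dividing them out of a critical value below
    \<open>r ^ d / real p ^ p\<close> leaves a product over \<open>K\<close> below
    \<open>t ^ p\<close>.\<close>
  define t where "t = r / real p"
  have t: "0 < t" "t < r" "t * real p = r"
    using r(1) p1 by (auto simp: t_def field_simps)
  have nearK: "\<exists>j\<in>K. absval (c i - \<beta> j) < t" if "i \<in> C" for i
  proof (rule prod_less_imp_factor_less)
    have i: "i < d - 1" "absval (c i - \<beta> j2) < r" using that by (auto simp: C_def)
    have "r \<le> absval (c i - \<beta> j)" if "j \<in> {..<d} - K" for j
    proof (rule ccontr)
      assume "\<not> r \<le> absval (c i - \<beta> j)"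
      then have "absval (\<beta> j - c i) < r" using less_sym by simp
      from less_trans[OF this i(2)] that show False by (simp add: K_def)
    qed
    then have "(\<Prod>j\<in>{..<d} - K. r) \<le> (\<Prod>j\<in>{..<d} - K. absval (c i - \<beta> j))"
      using r(1) by (intro prod_mono) auto
    then have ge: "r ^ (d - p) \<le> (\<Prod>j\<in>{..<d} - K. absval (c i - \<beta> j))"
      using card_rest by simp
    have "(\<Prod>j\<in>K. absval (c i - \<beta> j)) * r ^ (d - p)
        \<le> (\<Prod>j\<in>K. absval (c i - \<beta> j)) * (\<Prod>j\<in>{..<d} - K. absval (c i - \<beta> j))"
      using ge by (intro mult_left_mono prod_nonneg) auto
    also have "\<dots> = absval (poly f (c i))"
      unfolding absval_poly_f using prod.subset_diff[OF KJ, of "\<lambda>j. absval (c i - \<beta> j)"]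
      by (simp add: mult.commute)
    also have "\<dots> < r ^ d / real p ^ p" by (rule small'[OF i(1)])
    also have "r ^ d = r ^ p * r ^ (d - p)" using p(3) by (simp flip: power_add)
    also have "r ^ p * r ^ (d - p) / real p ^ p = t ^ p * r ^ (d - p)"
      by (simp add: t_def power_divide)
    finally show "(\<Prod>j\<in>K. absval (c i - \<beta> j)) < t ^ card K"
      unfolding card_K using r(1) by simp
  qed (use t in simp)
  have sub: "{k \<in> {..<d}. absval (\<beta> k - \<beta> j) < t} \<subseteq> K" if "j \<in> K" for j
  proof
    fix k assume k: "k \<in> {k \<in> {..<d}. absval (\<beta> k - \<beta> j) < t}"
    then have "absval (\<beta> k - \<beta> j) < r" using t(2) by simp
    then have "absval (\<beta> k - \<beta> j2) < r" using less_trans that by (simp add: K_def)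
    then show "k \<in> K" using k by (simp add: K_def)
  qed
  \<comment> \<open>The count is repeated at radius \<open>t\<close> inside \<open>K\<close>: tame
    clusters alone would give \<open>card C < card K = p\<close>. A cluster size divisible by
    \<open>p\<close> then fills all of \<open>K\<close>.\<close>
  have "\<exists>j\<in>K. p dvd card {k \<in> {..<d}. absval (\<beta> k - \<beta> j) < t}"
  proof (rule ccontr)
    assume none: "\<not> ?thesis"
    have "card C < card K"
    proof (rule card_less_of_clusters[of _ _ t c \<beta>])
      fix j assume j: "j \<in> K"
      have "{k \<in> K. absval (\<beta> k - \<beta> j) < t} = {k \<in> {..<d}. absval (\<beta> k - \<beta> j) < t}"
        using sub[OF j] KJ by blast
      moreover have "card {i \<in> C. absval (c i - \<beta> j) < t}
          \<le> card {i \<in> {..<d - 1}. absval (c i - \<beta> j) < t}"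
        using CI by (intro card_mono) auto
      moreover have "card {i \<in> {..<d - 1}. absval (c i - \<beta> j) < t}
          < card {k \<in> {..<d}. absval (\<beta> k - \<beta> j) < t}"
        using none j by (intro tame[OF t(1)]) blast
      ultimately show "card {i \<in> C. absval (c i - \<beta> j) < t} < card {k \<in> K. absval (\<beta> k - \<beta> j) < t}"
        by simp
    qed (use fin t nearK \<open>j2 \<in> K\<close> in auto)
    then show False using card_K card_C by simp
  qed
  then obtain j where j: "j \<in> K" "p dvd card {k \<in> {..<d}. absval (\<beta> k - \<beta> j) < t}" by blast
  have "j \<in> {k \<in> {..<d}. absval (\<beta> k - \<beta> j) < t}" using j(1) KJ t(1) by auto
  then have "0 < card {k \<in> {..<d}. absval (\<beta> k - \<beta> j) < t}" by (subst card_gt_0_iff) auto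
  then have "card K \<le> card {k \<in> {..<d}. absval (\<beta> k - \<beta> j) < t}"
    unfolding card_K using j(2) by (intro dvd_imp_le)
  then have all_close: "K = {k \<in> {..<d}. absval (\<beta> k - \<beta> j) < t}"
    using card_seteq[OF fin(1) sub[OF j(1)]] by simp
  define N where "N = card {i \<in> {..<d - 1}. absval (c i - \<beta> j) < t}"
  have "C \<subseteq> {i \<in> {..<d - 1}. absval (c i - \<beta> j) < t}"
  proof
    fix i assume i: "i \<in> C"
    obtain k where k: "k \<in> K" "absval (c i - \<beta> k) < t" using nearK[OF i] by blast
    have "absval (\<beta> k - \<beta> j) < t" using k(1) all_close by blast
    from less_trans[OF k(2) this] i CI show "i \<in> {i \<in> {..<d - 1}. absval (c i - \<beta> j) < t}" by blast
  qed
  then have "card C \<le> N" unfolding N_def by (intro card_mono) auto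
  then have pN: "p \<le> N" using card_C by simp
  \<comment> \<open>Contradiction at the coefficients \<open>p\<close> and \<open>Suc N\<close>. At
    radius \<open>r\<close> index \<open>p\<close> dominates \<open>g\<close>; at radius
    \<open>t\<close> index \<open>N \<ge> p\<close> strictly beats \<open>p - 1\<close> in the
    derivative, where the coefficient carries a loss of \<open>1 / p\<close>. Passing from
    \<open>r\<close> to \<open>t = r / p\<close> already costs index \<open>Suc N\<close> at least a
    factor \<open>p\<close> against \<open>p\<close>.\<close>
  define g where "g = shift (\<beta> j)"
  have "{k \<in> {..<d}. absval (\<beta> k - \<beta> j) < r} = K"
  proof -
    have "absval (\<beta> j - \<beta> j2) < r" using j(1) by (simp add: K_def)
    from less_trans[OF _ this] less_trans[OF _ less_sym[OF this]] show ?thesis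
      unfolding K_def by (intro Collect_cong) metis
  qed
  then have dom: "dominant r p g"
    using dominant_shift[OF r(1), of "\<beta> j"] card_K unfolding g_def by simp
  have dom': "dominant t N (pderiv g)"
    using dominant_pderiv_shift[OF t(1), of "\<beta> j"] unfolding g_def N_def .
  have gp: "coeff g p \<noteq> 0" using dom unfolding dominant_def by blast
  have "absval (coeff (pderiv g) (p - 1)) * t ^ (p - 1) < absval (coeff (pderiv g) N) * t ^ N"
    using dom' pN p1 unfolding dominant_def by simp
  then have "absval (of_nat p * coeff g p) * t ^ (p - 1) < absval (of_nat (Suc N) * coeff g (Suc N)) * t ^ N"
    using p1 by (simp add: coeff_pderiv del: of_nat_Suc)
  also have "\<dots> \<le> absval (coeff g (Suc N)) * t ^ N"
    using t(1) absval_of_nat_le_1[of "Suc N", where 'a='a]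
    by (intro mult_right_mono) (auto simp: absval_mult mult_left_le_one_le simp del: of_nat_Suc)
  finally have A: "absval (coeff g p) / real p * t ^ (p - 1) < absval (coeff g (Suc N)) * t ^ N"
    by (simp add: absval_mult p(2))
  have "absval (coeff g (Suc N)) * r ^ Suc N \<le> absval (coeff g p) * r ^ p"
    using dom unfolding dominant_def by blast
  then have B: "absval (coeff g (Suc N)) * (t ^ Suc N * real p ^ Suc N) \<le> absval (coeff g p) * (t ^ p * real p ^ p)"
    unfolding t(3)[symmetric] power_mult_distrib .
  have "absval (coeff g p) * t ^ p * real p ^ N = absval (coeff g p) / real p * t ^ (p - 1) * (t * real p ^ Suc N)"
    using p1 power_minus_mult[of p t] by (simp add: field_simps)
  also have "\<dots> < absval (coeff g (Suc N)) * t ^ N * (t * real p ^ Suc N)"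
    using A t(1) p1 by (intro mult_strict_right_mono) auto
  also have "\<dots> \<le> absval (coeff g p) * t ^ p * real p ^ p"
    using B by (simp add: mult_ac)
  also have "\<dots> \<le> absval (coeff g p) * t ^ p * real p ^ N"
    using pN p1 t(1) by (intro mult_left_mono power_increasing) auto
  finally show False by simp
qed

section \<open>Bounds for critical points of post-critically bounded polynomials\<close>

lemma critical_points_eq: "critical_points f = c ` {..<d - 1}"
  using d by (auto simp: critical_points_def deriv_eq poly_prod)

lemma obtain_max_crit:
  obtains i0 where "i0 < d - 1" "\<And>i. i < d - 1 \<Longrightarrow> absval (c i) \<le> absval (c i0)"
proof -
  define r where "r = Max ((\<lambda>i. absval (c i)) ` {..<d - 1})"
  have "r \<in> (\<lambda>i. absval (c i)) ` {..<d - 1}"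
    unfolding r_def using d by (intro Max_in) (auto simp: lessThan_empty_iff)
  then obtain i0 where "i0 < d - 1" "r = absval (c i0)" by auto
  moreover have "absval (c i) \<le> r" if "i < d - 1" for i
    unfolding r_def using that by (intro Max_ge) auto
  ultimately show ?thesis using that by metis
qed

text \<open>Common input for both degree ranges; \<open>q\<close> is the one exponent exempted from
  the comparison with \<open>d\<close>, later taken to be \<open>p\<close>.\<close>

lemma pcb_large_crit:
  assumes pcb: "post_critically_bounded f" and "poly f 0 = 0"
    and i0: "i0 < d - 1" "\<And>i. i < d - 1 \<Longrightarrow> absval (c i) \<le> absval (c i0)" "1 < absval (c i0)"
    and q: "\<And>n. 0 < n \<Longrightarrow> n < d \<Longrightarrow> n \<noteq> q \<Longrightarrow> absval (of_nat d :: 'a) \<le> absval (of_nat n :: 'a)"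
  obtains j0 where "j0 < d" "\<beta> j0 = 0"
    "\<And>j. j < d \<Longrightarrow> absval (\<beta> j) \<le> absval (c i0)"
    "\<And>i. i < d - 1 \<Longrightarrow> absval (poly f (c i)) \<le> absval (c i0)"
proof -
  obtain j0 where j0: "j0 < d" "\<beta> j0 = 0"
    using assms(2) by (auto simp: f_eq poly_prod)
  \<comment> \<open>The orbit is started at the critical value, so that the escape criterion bounds
    \<open>f (c i)\<close> itself.\<close>
  have orbit: "bounded (range (\<lambda>n. (poly f ^^ n) (poly f (c i))))" if "i < d - 1" for i
  proof (rule bounded_subset)
    show "bounded (range (\<lambda>n. (poly f ^^ n) (c i)))"
      using pcb that by (auto simp: post_critically_bounded_def critical_points_eq)
    have "(poly f ^^ n) (poly f (c i)) = (poly f ^^ Suc n) (c i)" for n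
      by (simp add: funpow_swap1)
    then show "range (\<lambda>n. (poly f ^^ n) (poly f (c i))) \<subseteq> range (\<lambda>n. (poly f ^^ n) (c i))"
      by blast
  qed
  have roots: "absval (\<beta> j) \<le> absval (c i0)" if "j < d" for j
    by (rule root_le_crit[OF i0(3,2,1) refl j0 q orbit[OF i0(1)] that])
  have "absval (poly f (c i)) \<le> absval (c i0)" if "i < d - 1" for i
    by (rule bounded_orbit_imp_le[OF _ roots orbit[OF that]]) (use i0(3) in linarith)
  with j0 roots show ?thesis using that by blast
qed

text \<open>If the largest critical point has size \<open>r > 1\<close>, some critical value is at
  least \<open>r ^ d / real p ^ p\<close> and all are at most \<open>r\<close>; cancel one factor
  \<open>r\<close>.\<close>

lemma pcb_crit_bound:
  assumes "post_critically_bounded f" "poly f 0 = 0"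
    and p: "prime p" "absval (of_nat p :: 'a) = 1 / real p" "p < d" "d < 2 * p" and "i < d - 1"
  shows "absval (c i) ^ (d - 1) \<le> real p ^ p"
proof -
  obtain i0 where i0: "i0 < d - 1" "\<And>i. i < d - 1 \<Longrightarrow> absval (c i) \<le> absval (c i0)"
    using obtain_max_crit by blast
  define r where "r = absval (c i0)"
  have "r ^ (d - 1) \<le> real p ^ p"
  proof (cases "r \<le> 1")
    case True
    then have "r ^ (d - 1) \<le> 1" by (intro power_le_one) (auto simp: r_def)
    also have "1 \<le> real p ^ p" using prime_gt_1_nat[OF p(1)] by (intro one_le_power) auto
    finally show ?thesis .
  next
    case False
    then have r: "1 < absval (c i0)" by (simp add: r_def)
    have q: "absval (of_nat d :: 'a) \<le> absval (of_nat n :: 'a)" if "0 < n" "n < d" "n \<noteq> p" for n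
    proof -
      have "\<not> p dvd n" using that p by (intro not_dvd_below_double) auto
      then show ?thesis using absval_of_nat_not_dvd[OF p(1,2)] absval_of_nat_le_1[of d] by simp
    qed
    obtain j0 where j0: "j0 < d" "\<beta> j0 = 0" "\<And>j. j < d \<Longrightarrow> absval (\<beta> j) \<le> r"
        "\<And>i. i < d - 1 \<Longrightarrow> absval (poly f (c i)) \<le> r"
      using pcb_large_crit[OF assms(1,2) i0 r q] unfolding r_def by blast
    have "\<exists>i<d - 1. r ^ d / real p ^ p \<le> absval (poly f (c i))"
      by (rule critical_value_large[OF p _ j0(3) _ i0(1) _ j0(1,2)]) (use False i0 in \<open>auto simp: r_def\<close>)
    then obtain i where "i < d - 1" "r ^ d / real p ^ p \<le> absval (poly f (c i))" by blast
    then have "r ^ d / real p ^ p \<le> r" using j0(4) order_trans by blast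
    then have "r ^ d \<le> real p ^ p * r"
      using prime_gt_0_nat[OF p(1)] by (simp add: divide_le_eq mult.commute)
    then have "r ^ (d - 1) * r \<le> real p ^ p * r"
      using power_minus_mult[of d r] d by simp
    then show ?thesis using False by simp
  qed
  moreover have "absval (c i) ^ (d - 1) \<le> r ^ (d - 1)"
    using i0(2) \<open>i < d - 1\<close> by (intro power_mono) (auto simp: r_def)
  ultimately show ?thesis by linarith
qed

lemma pcb_crit_bound_degree_double:
  assumes "post_critically_bounded f" "poly f 0 = 0"
    and p: "prime p" "absval (of_nat p :: 'a) = 1 / real p" "d = 2 * p" and "i < d - 1"
  shows "absval (c i) \<le> 1"
proof (rule ccontr)
  assume contra: "\<not> absval (c i) \<le> 1"
  obtain i0 where i0: "i0 < d - 1" "\<And>i. i < d - 1 \<Longrightarrow> absval (c i) \<le> absval (c i0)"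
    using obtain_max_crit by blast
  define r where "r = absval (c i0)"
  have r: "1 < absval (c i0)" using i0(2)[OF \<open>i < d - 1\<close>] contra by simp
  have q: "absval (of_nat d :: 'a) \<le> absval (of_nat n :: 'a)" if "0 < n" "n < d" "n \<noteq> p" for n
  proof -
    have "\<not> p dvd n" using that p by (intro not_dvd_below_double) auto
    then show ?thesis using absval_of_nat_not_dvd[OF p(1,2)] absval_of_nat_le_1[of d] by simp
  qed
  obtain j0 where j0: "j0 < d" "\<beta> j0 = 0" "\<And>j. j < d \<Longrightarrow> absval (\<beta> j) \<le> r"
      "\<And>i. i < d - 1 \<Longrightarrow> absval (poly f (c i)) \<le> r"
    using pcb_large_crit[OF assms(1,2) i0 r q] unfolding r_def by blast
  have "\<exists>i<d - 1. r ^ d \<le> absval (poly f (c i))"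
    by (rule critical_value_large_degree_double[OF p _ j0(3) _ i0(1) _ j0(1,2)])
      (use r i0 in \<open>auto simp: r_def\<close>)
  then have "r ^ d \<le> r" using j0(4) order_trans by blast
  moreover have "r ^ 1 < r ^ d" using r d by (intro power_strict_increasing) (auto simp: r_def)
  ultimately show False by simp
qed

end

section \<open>From absolute values to the supremum of negated valuations\<close>

lemma split_poly_exists:
  fixes f :: "'a::nonarch_valued_field poly"
  assumes cp: "padic_complex_field p TYPE('a)" and "2 \<le> d" "f \<in> monic_polys d"
  shows "\<exists>\<beta> c. split_poly f d \<beta> c"
proof -
  have f: "degree f = d" "lead_coeff f = 1" using assms(3) by (auto simp: monic_polys_def)
  obtain \<beta> where \<beta>: "f = (\<Prod>j<d. [:- \<beta> j, 1:])"
    using padic_complex_monic_splits[OF cp f] by blast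
  define g where "g = smult (inverse (of_nat d)) (pderiv f)"
  have d0: "(of_nat d :: 'a) \<noteq> 0" using assms(2) by simp
  have "degree g = d - 1"
    using d0 by (simp add: g_def degree_pderiv f)
  moreover have "lead_coeff g = 1"
    unfolding \<open>degree g = d - 1\<close> using d0 f assms(2) by (simp add: g_def coeff_pderiv del: of_nat_Suc)
  ultimately obtain c where c: "g = (\<Prod>i<d - 1. [:- c i, 1:])"
    using padic_complex_monic_splits[OF cp] by blast
  have "pderiv f = smult (of_nat d) g" using d0 by (simp add: g_def)
  then have "split_poly f d \<beta> c"
    unfolding split_poly_def using assms(2) \<beta> c by simp
  then show ?thesis by blast
qed

lemma neg_padic_val_le_iff:
  assumes "1 < p"
  shows "- padic_val p x \<le> ereal a \<longleftrightarrow> absval (x :: 'a::nonarch_valued_field) \<le> real p powr a"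
proof (cases "x = 0")
  case True
  then show ?thesis by (simp add: padic_val_def)
next
  case False
  then show ?thesis using assms by (simp add: padic_val_def log_le_iff)
qed

lemma neg_padic_val_eq:
  assumes "1 < p" "absval (x :: 'a::nonarch_valued_field) = real p powr a"
  shows "- padic_val p x = ereal a"
proof -
  have "x \<noteq> 0" using assms by (metis absval_0 of_nat_0_less_iff less_irrefl powr_gt_zero zero_less_one less_trans)
  then show ?thesis using assms by (simp add: padic_val_def)
qed

lemma mandelbrot_radius_eq:
  fixes a :: real
  assumes cp: "padic_complex_field p TYPE('a::nonarch_valued_field)" and "1 < p" "2 \<le> d"
    and upper: "\<And>f \<beta> c i. split_poly f d \<beta> c \<Longrightarrow> post_critically_bounded f \<Longrightarrow> poly f (0 :: 'a) = 0
      \<Longrightarrow> i < d - 1 \<Longrightarrow> absval (c i) \<le> real p powr a"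
    and lower: "\<exists>f \<in> (pcb_polys d :: 'a poly set). \<exists>x \<in> critical_points f. absval x = real p powr a"
  shows "mandelbrot_radius TYPE('a) d p = ereal a"
proof (rule antisym)
  have ex: "\<exists>\<beta> c. split_poly f d \<beta> c" if "f \<in> pcb_polys d" for f :: "'a poly"
    using split_poly_exists[OF cp assms(3)] that by (auto simp: pcb_polys_def)
  have fin: "finite (critical_points f)" if "f \<in> pcb_polys d" for f :: "'a poly"
    using ex[OF that] split_poly.critical_points_eq by fastforce
  show "mandelbrot_radius TYPE('a) d p \<le> ereal a"
    unfolding mandelbrot_radius_def
  proof (rule SUP_least)
    fix f :: "'a poly" assume f: "f \<in> pcb_polys d"
    obtain \<beta> c where s: "split_poly f d \<beta> c" using ex[OF f] by blast
    have ne: "critical_points f \<noteq> {}"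
      using split_poly.critical_points_eq[OF s] assms(3) by (auto simp: lessThan_empty_iff)
    have "- padic_val p x \<le> ereal a" if "x \<in> critical_points f" for x
      unfolding neg_padic_val_le_iff[OF assms(2)]
      using upper[OF s] f that split_poly.critical_points_eq[OF s]
      by (auto simp: pcb_polys_def monic_polys_def)
    then show "Max ((\<lambda>c. - padic_val p c) ` critical_points f) \<le> ereal a"
      using fin[OF f] ne by (intro Max.boundedI) auto
  qed
  obtain f :: "'a poly" and x where f: "f \<in> pcb_polys d" "x \<in> critical_points f" "absval x = real p powr a"
    using lower by blast
  have "ereal a = - padic_val p x" using neg_padic_val_eq[OF assms(2) f(3)] by simp
  also have "\<dots> \<le> Max ((\<lambda>c. - padic_val p c) ` critical_points f)"
    using fin[OF f(1)] f(2) by (intro Max_ge) auto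
  finally show "ereal a \<le> mandelbrot_radius TYPE('a) d p"
    unfolding mandelbrot_radius_def by (rule SUP_upper2[OF f(1)])
qed

section \<open>Extremal polynomials\<close>

text \<open>\<open>z^(d-p) (z-b)^p\<close> has critical points \<open>0\<close>, \<open>b\<close> and \<open>x = (d-p)b/d\<close>; choosing \<open>b\<close> such
  that \<open>x\<close> is mapped to \<open>b\<close>, hence to \<open>0\<close>, makes it post-critically finite.\<close>

lemma extremal_poly:
  assumes cp: "padic_complex_field p TYPE('a::nonarch_valued_field)" and p: "prime p" "p < d" "d < 2 * p"
  shows "\<exists>f \<in> (pcb_polys d :: 'a poly set). \<exists>x \<in> critical_points f.
    absval x = real p powr (real p / (real d - 1))"
proof -
  have absp: "absval (of_nat p :: 'a) = 1 / real p" using cp by (simp add: padic_complex_field_def)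
  have p1: "1 < p" using prime_gt_1_nat[OF p(1)] .
  have "\<not> p dvd d" using p by (intro not_dvd_below_double) auto
  then have absd: "absval (of_nat d :: 'a) = 1" by (rule absval_of_nat_not_dvd[OF p(1) absp])
  have "\<not> p dvd (d - p)" using p by (intro nat_dvd_not_less) auto
  then have absdp: "absval (of_nat (d - p) :: 'a) = 1" by (rule absval_of_nat_not_dvd[OF p(1) absp])
  define D P E where "D = (of_nat d :: 'a)" and "P = (of_nat p :: 'a)" and "E = (of_nat (d - p) :: 'a)"
  have nz: "D \<noteq> 0" "P \<noteq> 0" "E \<noteq> 0" using p p1 by (auto simp: D_def P_def E_def)
  have EDP: "E = D - P" using p(2) by (simp add: D_def P_def E_def of_nat_diff)
  \<comment> \<open>With \<open>x = E / D * b\<close> and \<open>x - b = - P / D * b\<close> one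
    gets \<open>f(x) = \<kappa> * b ^ d\<close>. So \<open>f(x) = b\<close> amounts to
    \<open>b ^ (d - 1) = inverse \<kappa>\<close>, and the factor \<open>P ^ p\<close> in
    \<open>\<kappa>\<close> produces the size \<open>real p ^ p\<close>.\<close>
  define \<kappa> where "\<kappa> = (E / D) ^ (d - p) * (- P / D) ^ p"
  have abs\<kappa>: "absval \<kappa> = 1 / real p ^ p"
    using absd absdp absp by (simp add: \<kappa>_def absval_mult D_def P_def E_def power_divide)
  have \<kappa>0: "\<kappa> \<noteq> 0" using nz by (simp add: \<kappa>_def)
  define h where "h = monom 1 (d - 1) + [:- inverse \<kappa>:]"
  have d1: "0 < d - 1" using p p1 by simp
  have deg: "degree h = d - 1"
    unfolding h_def using d1 by (subst degree_add_eq_left) (auto simp: degree_monom_eq)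
  have "lead_coeff h = 1"
    unfolding deg using d1 by (simp add: h_def coeff_pCons split: nat.splits)
  then obtain b where "poly h b = 0"
    using padic_complex_root_exists[OF cp deg d1] by blast
  then have b: "b ^ (d - 1) = inverse \<kappa>" by (simp add: h_def poly_monom)
  have "b ^ d = inverse \<kappa> * b"
    unfolding b[symmetric] using p by (intro power_minus_mult[symmetric]) simp
  then have b\<kappa>: "b ^ d * \<kappa> = b" using \<kappa>0 by simp
  have b0: "b \<noteq> 0" using b \<kappa>0 d1 by (metis inverse_nonzero_iff_nonzero power_0_left less_irrefl)
  define f where "f = [:0, 1:] ^ (d - p) * [:- b, 1:] ^ p"
  define x where "x = E / D * b"
  have polyf: "poly f z = z ^ (d - p) * (z - b) ^ p" for z by (simp add: f_def)
  have xb: "x - b = - P / D * b" using nz by (simp add: x_def EDP field_simps)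
  have "poly f x = b ^ (d - p) * b ^ p * \<kappa>"
    unfolding polyf xb unfolding x_def \<kappa>_def power_mult_distrib by (simp only: mult_ac)
  then have fx: "poly f x = b"
    using b\<kappa> p(2) by (simp flip: power_add)
  have f0: "poly f 0 = 0" "poly f b = 0" using p p1 by (auto simp: polyf)
  have "degree f = d"
    using p(2) by (simp add: f_def degree_mult_eq degree_power_eq)
  moreover have "lead_coeff f = 1"
    by (simp only: f_def lead_coeff_mult lead_coeff_power) simp
  ultimately have monic: "f \<in> monic_polys d" using f0 by (simp add: monic_polys_def)
  have deriv: "poly (pderiv f) z = z ^ (d - p - 1) * (z - b) ^ (p - 1) * (D * z - E * b)" for z
  proof -
    obtain m where m: "d - p = Suc m" using p(2) by (metis Suc_diff_Suc)
    obtain k where k: "p = Suc k" using p1 by (cases p) auto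
    have exps: "d - p - 1 = m" "p - 1 = k" using m k by auto
    have f_eq: "f = [:0, 1:] ^ Suc m * [:- b, 1:] ^ Suc k"
      unfolding f_def m by (subst k) (rule refl)
    have D: "D = of_nat (Suc m) + of_nat (Suc k)"
      using m k p(2) by (simp add: D_def flip: of_nat_add del: of_nat_Suc)
    have E: "E = of_nat (Suc m)" using m by (simp add: E_def)
    have "poly (pderiv f) z = z ^ Suc m * (of_nat (Suc k) * (z - b) ^ k) + (z - b) ^ Suc k * (of_nat (Suc m) * z ^ m)"
      unfolding f_eq pderiv_mult pderiv_power_Suc
      by (simp add: pderiv_pCons del: of_nat_Suc power_Suc)
    also have "\<dots> = z ^ m * (z - b) ^ k * (D * z - E * b)"
      unfolding D E by (simp add: algebra_simps)
    finally show ?thesis unfolding exps .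
  qed
  have crit: "z = 0 \<or> z = b \<or> z = x" if "z \<in> critical_points f" for z
  proof -
    have "z = 0 \<or> z - b = 0 \<or> D * z - E * b = 0"
      using that deriv[of z] unfolding critical_points_def by auto
    then show ?thesis using nz by (auto simp: x_def field_simps)
  qed
  have zero: "(poly f ^^ n) 0 = 0" for n by (induction n) (auto simp: f0)
  have orb_b: "(poly f ^^ n) b \<in> {0, b}" for n
    using zero f0 by (cases n) (auto simp: funpow_swap1 simp del: funpow.simps(2) simp: funpow_Suc_right)
  have orb_x: "(poly f ^^ n) x \<in> {0, b, x}" for n
    using orb_b[of "n - 1"] fx by (cases n) (auto simp: funpow_Suc_right simp del: funpow.simps(2))
  have "bounded (range (\<lambda>n. (poly f ^^ n) z))" if "z \<in> critical_points f" for z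
  proof (rule bounded_subset)
    show "bounded {0, b, x}" by (intro finite_imp_bounded) auto
    show "range (\<lambda>n. (poly f ^^ n) z) \<subseteq> {0, b, x}"
      using crit[OF that] zero orb_b orb_x by auto
  qed
  then have "f \<in> pcb_polys d"
    using monic by (simp add: pcb_polys_def post_critically_bounded_def)
  moreover have "x \<in> critical_points f"
    using nz by (simp add: critical_points_def deriv x_def)
  moreover have "absval x = real p powr (real p / (real d - 1))"
  proof -
    have "absval b ^ (d - 1) = real p ^ p"
      using arg_cong[OF b, of absval] abs\<kappa> by simp
    then have "absval b powr real (d - 1) = real p powr real p"
      using b0 p1 by (simp add: powr_realpow)
    then have "(absval b powr real (d - 1)) powr (1 / real (d - 1)) = (real p powr real p) powr (1 / real (d - 1))"
      by simp
    then have "absval b = real p powr (real p / real (d - 1))"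
      using d1 b0 by (simp add: powr_powr)
    moreover have "absval x = absval b"
      using absd absdp by (simp add: x_def absval_mult D_def E_def)
    moreover have "real (d - 1) = real d - 1" using d1 by simp
    ultimately show ?thesis by simp
  qed
  ultimately show ?thesis by blast
qed

text \<open>The polynomial \<open>z ^ d - d * z\<close> has integer coefficients, so it preserves
  the closed unit disc, and its critical points are the roots of unity of order dividing
  \<open>d - 1\<close>.\<close>

lemma pcb_poly_with_unit_critical_point:
  assumes "2 \<le> d"
  shows "\<exists>f \<in> (pcb_polys d :: 'a::nonarch_valued_field poly set). \<exists>x \<in> critical_points f. absval x = 1"
proof -
  define f :: "'a poly" where "f = monom 1 d + smult (- of_nat d) [:0, 1:]"
  have polyf: "poly f z = z ^ d - of_nat d * z" for z by (simp add: f_def poly_monom)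
  have deriv: "poly (pderiv f) z = of_nat d * (z ^ (d - 1) - 1)" for z
    by (simp add: f_def pderiv_add pderiv_monom pderiv_smult pderiv_pCons poly_monom algebra_simps)
  have deg: "degree f = d"
    unfolding f_def using assms by (subst degree_add_eq_left) (auto simp: degree_monom_eq)
  moreover have "lead_coeff f = 1"
    unfolding deg using assms by (simp add: f_def coeff_pCons split: nat.splits)
  ultimately have "f \<in> monic_polys d" using assms by (simp add: monic_polys_def polyf)
  moreover have "bounded (range (\<lambda>n. (poly f ^^ n) z))" if "z \<in> critical_points f" for z
  proof -
    have "z ^ (d - 1) = 1" using that assms by (simp add: critical_points_def deriv)
    then have "absval z ^ (d - 1) = 1" by (metis absval_1 absval_power)
    then have z: "absval z = 1" using power_eq_imp_eq_base[of "absval z" "d - 1" 1] assms by simp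
    have "absval ((poly f ^^ n) z) \<le> 1" for n
    proof (induction n)
      case (Suc n)
      let ?y = "(poly f ^^ n) z"
      have "absval (?y ^ d) \<le> 1" using Suc by (simp add: power_le_one)
      moreover have "absval (of_nat d * ?y) \<le> 1"
        using Suc absval_of_nat_le_1[of d, where 'a='a] by (simp add: absval_mult mult_le_one)
      ultimately show ?case
        using absval_diff_le_max[of "?y ^ d" "of_nat d * ?y"] polyf[of ?y] by simp
    qed (simp add: z)
    then show ?thesis
      unfolding bounded_def by (intro exI[of _ 0] exI[of _ 1]) (auto simp: dist_absval)
  qed
  ultimately have "f \<in> pcb_polys d" by (simp add: pcb_polys_def post_critically_bounded_def)
  moreover have "1 \<in> critical_points f" by (simp add: critical_points_def deriv)
  ultimately show ?thesis using absval_1 by blast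
qed

theorem theorem1p1:
  fixes p d :: nat
  assumes "prime p"
    and "d \<ge> 2"
    and "padic_complex_field p TYPE('a::nonarch_valued_field)"
  shows "(real d / 2 < real p \<and> p < d \<longrightarrow>
            mandelbrot_radius TYPE('a) d p = ereal (real p / (real d - 1))) \<and>
         (real p = real d / 2 \<longrightarrow> mandelbrot_radius TYPE('a) d p = 0)"
proof (intro conjI impI)
  have p1: "1 < p" using prime_gt_1_nat[OF assms(1)] .
  have absp: "absval (of_nat p :: 'a) = 1 / real p" using assms(3) by (simp add: padic_complex_field_def)
  {
    assume "real d / 2 < real p \<and> p < d"
    then have d: "p < d" "d < 2 * p" by auto
    show "mandelbrot_radius TYPE('a) d p = ereal (real p / (real d - 1))"
    proof (rule mandelbrot_radius_eq[OF assms(3) p1 assms(2) _ extremal_poly[OF assms(3,1) d]])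
      fix f :: "'a poly" and \<beta> c i
      assume f: "split_poly f d \<beta> c" "post_critically_bounded f" "poly f 0 = 0" "i < d - 1"
      have le: "absval (c i) ^ (d - 1) \<le> real p ^ p"
        by (rule split_poly.pcb_crit_bound[OF f(1-3) assms(1) absp d f(4)])
      \<comment> \<open>The \<open>(d - 1)\<close>-th root of \<open>real p ^ p\<close>, so that the
        bound can be compared on \<open>(d - 1)\<close>-th powers.\<close>
      define y where "y = real p powr (real p / (real d - 1))"
      have "y ^ (d - 1) = y powr real (d - 1)" using p1 by (simp add: y_def powr_realpow)
      also have "\<dots> = real p powr real p" using assms(2) by (simp add: y_def powr_powr of_nat_diff)
      also have "\<dots> = real p ^ p" using p1 by (simp add: powr_realpow)
      finally have "absval (c i) ^ (d - 1) \<le> y ^ (d - 1)" using le by simp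
      then show "absval (c i) \<le> y"
        using assms(2) by (subst (asm) power_mono_iff) (auto simp: y_def)
    qed
  }
  {
    assume "real p = real d / 2"
    then have d: "d = 2 * p" by simp
    have "mandelbrot_radius TYPE('a) d p = ereal 0"
    proof (rule mandelbrot_radius_eq[OF assms(3) p1 assms(2)])
      show "\<exists>f \<in> (pcb_polys d :: 'a poly set). \<exists>x \<in> critical_points f. absval x = real p powr 0"
        using pcb_poly_with_unit_critical_point[OF assms(2)] p1 by simp
      fix f :: "'a poly" and \<beta> c i
      assume f: "split_poly f d \<beta> c" "post_critically_bounded f" "poly f 0 = 0" "i < d - 1"
      show "absval (c i) \<le> real p powr 0"
        using split_poly.pcb_crit_bound_degree_double[OF f(1-3) assms(1) absp d f(4)] p1 by simp
    qed
    then show "mandelbrot_radius TYPE('a) d p = 0" by (simp add: zero_ereal_def)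
  }
qed

end
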